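(* Let $\mathcal{E}$ be any voting rule whose winner problem is solvable in polynomial time, and let $k$ be any fixed nonnegative integer. Then $\mathcal{E}$-Conformant Manipulation restricted to instances with exactly $k$ manipulators is in $\mathrm{P}$.
   Context: An election $(C,V)$ consists of a finite set of candidates $C$ and a finite collection (multiset, listed explicitly) of voters $V$; each voter has a vote, which is a strict total order over $C$. A voting rule $\mathcal{E}$ maps each election to a subset of its candidate set, the $\mathcal{E}$-winners. The winner problem of $\mathcal{E}$ is: given an election $(C,V)$ and a candidate $p\in C$, is $p$ an $\mathcal{E}$-winner of $(C,V)$? $\mathcal{E}$-Conformant Manipulation is the following decision problem. Given: an election $(C,V)$, a collection of manipulative voters $W$ (whose votes are not yet set), and a preferred candidate $p\in C$. Question: does there exist a way to set the votes of the manipulators in $W$ using only votes that occur in $V$ (a vote may be used by any number of manipulators; every manipulator must cast a vote) such that $p$ is an $\mathcal{E}$-winner of the election $(C,V\cup W)$? *)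

theory Defs
  imports Complex_Main "HOL-Library.Multiset" "HOL-Computational_Algebra.Polynomial"
begin

section \<open>Deterministic multitape Turing machines and the class P\<close>

text \<open>
  Tape symbols and states are natural numbers below bounds fixed by the machine; symbol 0 is the
  blank. Tapes are infinite in both directions and are stored relative to the head, i.e. \<open>t i\<close> is
  the symbol \<open>i\<close> cells to the right of the head. Moving the head shifts the function.
\<close>

type_synonym tape = "int \<Rightarrow> nat"

datatype move = Move_Left | Stay | Move_Right

record turing_machine =
  num_tapes :: nat
  num_states :: nat
  num_symbols :: nat
  start_state :: nat
  accept_state :: nat
  reject_state :: nat
  transition :: "nat \<Rightarrow> nat list \<Rightarrow> nat \<times> (nat \<times> move) list"

definition wf_turing_machine :: "turing_machine \<Rightarrow> bool" where
  "wf_turing_machine M \<longleftrightarrow>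
     num_tapes M \<ge> 1 \<and>
     start_state M < num_states M \<and> accept_state M < num_states M \<and>
     reject_state M < num_states M \<and> accept_state M \<noteq> reject_state M \<and>
     (\<forall>q < num_states M. \<forall>ss. length ss = num_tapes M \<and> set ss \<subseteq> {..<num_symbols M} \<longrightarrow>
        (case transition M q ss of (q', acts) \<Rightarrow>
           q' < num_states M \<and> length acts = num_tapes M \<and>
           (\<forall>(s, m) \<in> set acts. s < num_symbols M)))"

fun shift_tape :: "move \<Rightarrow> tape \<Rightarrow> tape" where
  "shift_tape Move_Left t = (\<lambda>i. t (i - 1))"
| "shift_tape Stay t = t"
| "shift_tape Move_Right t = (\<lambda>i. t (i + 1))"

fun act_tape :: "nat \<times> move \<Rightarrow> tape \<Rightarrow> tape" where
  "act_tape (s, m) t = shift_tape m (t(0 := s))"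

type_synonym tm_config = "nat \<times> tape list"

fun tm_step :: "turing_machine \<Rightarrow> tm_config \<Rightarrow> tm_config" where
  "tm_step M (q, ts) =
     (if q = accept_state M \<or> q = reject_state M then (q, ts)
      else (case transition M q (map (\<lambda>t. t 0) ts) of
              (q', acts) \<Rightarrow> (q', map2 act_tape acts ts)))"

definition blank_tape :: tape where
  "blank_tape = (\<lambda>_. 0)"

definition input_tape :: "nat list \<Rightarrow> tape" where
  "input_tape x = (\<lambda>i. if 0 \<le> i \<and> i < int (length x) then x ! nat i else 0)"

definition tm_init :: "turing_machine \<Rightarrow> nat list \<Rightarrow> tm_config" where
  "tm_init M x = (start_state M, input_tape x # replicate (num_tapes M - 1) blank_tape)"

text \<open>The input alphabet of size \<open>\<sigma>\<close> is \<open>{1..\<sigma>}\<close>.\<close>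

definition decides_in_time ::
  "turing_machine \<Rightarrow> nat \<Rightarrow> nat list set \<Rightarrow> (nat \<Rightarrow> nat) \<Rightarrow> bool" where
  "decides_in_time M \<sigma> L T \<longleftrightarrow>
     wf_turing_machine M \<and> \<sigma> < num_symbols M \<and> L \<subseteq> lists {1..\<sigma>} \<and>
     (\<forall>x \<in> lists {1..\<sigma>}. \<exists>t \<le> T (length x).
        fst ((tm_step M ^^ t) (tm_init M x)) = (if x \<in> L then accept_state M else reject_state M))"

definition class_P :: "nat \<Rightarrow> nat list set set" where
  "class_P \<sigma> = {L. \<exists>M (p :: nat poly). decides_in_time M \<sigma> L (poly p)}"


section \<open>Elections, winners and conformant manipulation\<close>

text \<open>Candidates are named by natural numbers. \<open>(c, d) \<in> r\<close> means that \<open>c\<close> is preferred to \<open>d\<close>.\<close>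

type_synonym cand = nat
type_synonym vote = "(cand \<times> cand) set"

definition is_vote :: "cand set \<Rightarrow> vote \<Rightarrow> bool" where
  "is_vote C r \<longleftrightarrow> r \<subseteq> C \<times> C \<and> strict_linear_order_on C r"

definition is_election :: "cand set \<Rightarrow> vote multiset \<Rightarrow> bool" where
  "is_election C V \<longleftrightarrow> finite C \<and> (\<forall>r \<in># V. is_vote C r)"

type_synonym rule = "cand set \<Rightarrow> vote multiset \<Rightarrow> cand set"

definition voting_rule :: "rule \<Rightarrow> bool" where
  "voting_rule E \<longleftrightarrow> (\<forall>C V. is_election C V \<longrightarrow> E C V \<subseteq> C)"

text \<open>Decision problems as sets of yes-instances.\<close>

definition winner_problem :: "rule \<Rightarrow> (cand set \<times> vote multiset \<times> cand) set" where
  "winner_problem E = {(C, V, p). is_election C V \<and> p \<in> C \<and> p \<in> E C V}"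

text \<open>
  Manipulators are interchangeable, so the collection of manipulators is given by its size \<open>w\<close>;
  \<open>ws ! i\<close> is the vote assigned to manipulator \<open>i\<close>.
\<close>

definition conformant_manipulation ::
  "rule \<Rightarrow> (cand set \<times> vote multiset \<times> nat \<times> cand) set" where
  "conformant_manipulation E =
     {(C, V, w, p). is_election C V \<and> p \<in> C \<and>
        (\<exists>ws. length ws = w \<and> set ws \<subseteq> set_mset V \<and> p \<in> E C (V + mset ws))}"


section \<open>Encoding of instances\<close>

text \<open>A vote is written down as the list of all candidates, most preferred first.\<close>

definition ranking_order :: "cand list \<Rightarrow> vote" where
  "ranking_order v = {(v ! i, v ! j) | i j. i < j \<and> j < length v}"

definition is_ranking :: "cand set \<Rightarrow> cand list \<Rightarrow> bool" where
  "is_ranking C v \<longleftrightarrow> distinct v \<and> set v = C"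

text \<open>
  The alphabet is \<open>{1..4}\<close>: bits 0 and 1 are the symbols 1 and 2, symbol 3 terminates a number and
  symbol 4 terminates a list. Numbers are in binary, least significant bit first.
\<close>

fun bin_nat :: "nat \<Rightarrow> nat list" where
  "bin_nat n = (if n = 0 then [] else (n mod 2 + 1) # bin_nat (n div 2))"

declare bin_nat.simps [simp del]

definition enc_nat :: "nat \<Rightarrow> nat list" where
  "enc_nat n = bin_nat n @ [3]"

definition enc_nats :: "nat list \<Rightarrow> nat list" where
  "enc_nats xs = concat (map enc_nat xs) @ [4]"

definition enc_winner :: "cand list \<Rightarrow> cand list list \<Rightarrow> cand \<Rightarrow> nat list" where
  "enc_winner cs vs p = enc_nat p @ enc_nats cs @ concat (map enc_nats vs)"

text \<open>The manipulators are listed explicitly, one symbol 3 for each of them.\<close>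

definition enc_conformant :: "cand list \<Rightarrow> cand list list \<Rightarrow> nat \<Rightarrow> cand \<Rightarrow> nat list" where
  "enc_conformant cs vs w p = replicate w 3 @ [4] @ enc_winner cs vs p"

text \<open>
  The languages of a winner problem and of a conformant manipulation problem: all encodings of
  yes-instances. The order in which candidates and voters are listed is arbitrary.
\<close>

definition winner_language ::
  "(cand set \<times> vote multiset \<times> cand) set \<Rightarrow> nat list set" where
  "winner_language A =
     {enc_winner cs vs p | cs vs p.
        distinct cs \<and> (\<forall>v \<in> set vs. is_ranking (set cs) v) \<and>
        (set cs, mset (map ranking_order vs), p) \<in> A}"

definition conformant_language ::
  "(cand set \<times> vote multiset \<times> nat \<times> cand) set \<Rightarrow> nat list set" where
  "conformant_language A =
     {enc_conformant cs vs w p | cs vs w p.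
        distinct cs \<and> (\<forall>v \<in> set vs. is_ranking (set cs) v) \<and>
        (set cs, mset (map ranking_order vs), w, p) \<in> A}"


section \<open>The encoding is adequate\<close>

text \<open>Rankings denote exactly the strict total orders, and encodings determine the instance.\<close>

lemma is_vote_ranking_order:
  assumes "is_ranking C v"
  shows "is_vote C (ranking_order v)"
proof -
  have d: "distinct v" and s: "set v = C"
    using assms by (auto simp: is_ranking_def)
  have "trans (ranking_order v)"
  proof (rule transI)
    fix x y z assume "(x, y) \<in> ranking_order v" "(y, z) \<in> ranking_order v"
    then obtain i j j' l where *: "x = v ! i" "y = v ! j" "i < j" "j < length v"
      "y = v ! j'" "z = v ! l" "j' < l" "l < length v"
      by (auto simp: ranking_order_def)
    then have "j = j'"
      using d nth_eq_iff_index_eq[of v j j'] by simp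
    then show "(x, z) \<in> ranking_order v"
      using * unfolding ranking_order_def by force
  qed
  moreover have "irrefl (ranking_order v)"
    using d by (auto simp: irrefl_def ranking_order_def nth_eq_iff_index_eq)
  moreover have "total_on C (ranking_order v)"
  proof (rule total_onI)
    fix x y assume "x \<in> C" "y \<in> C" "x \<noteq> y"
    then obtain i j where "x = v ! i" "y = v ! j" "i < length v" "j < length v" "i \<noteq> j"
      using s by (metis in_set_conv_nth)
    then show "(x, y) \<in> ranking_order v \<or> (y, x) \<in> ranking_order v"
      unfolding ranking_order_def by (cases i j rule: linorder_cases) auto
  qed
  moreover have "ranking_order v \<subseteq> C \<times> C"
    using s by (auto simp: ranking_order_def)
  ultimately show ?thesis
    by (simp add: is_vote_def strict_linear_order_on_def)
qed

lemma ex_less_Suc_split: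
  "(\<exists>i j. i < j \<and> j < Suc n \<and> P i j) \<longleftrightarrow>
     (\<exists>j<n. P 0 (Suc j)) \<or> (\<exists>i j. i < j \<and> j < n \<and> P (Suc i) (Suc j))"
proof
  assume "\<exists>i j. i < j \<and> j < Suc n \<and> P i j"
  then obtain i j where *: "i < j" "j < Suc n" "P i j" by blast
  then obtain j' where "j = Suc j'" by (cases j) auto
  then show "(\<exists>j<n. P 0 (Suc j)) \<or> (\<exists>i j. i < j \<and> j < n \<and> P (Suc i) (Suc j))"
    using * by (cases i) auto
qed blast

lemma mem_ranking_order_iff:
  "(a, b) \<in> ranking_order v \<longleftrightarrow> (\<exists>i j. i < j \<and> j < length v \<and> a = v ! i \<and> b = v ! j)"
  unfolding ranking_order_def by blast

lemma ranking_order_Cons: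
  "ranking_order (x # v) = {x} \<times> set v \<union> ranking_order v"
proof (rule set_eqI, clarify)
  fix a b
  show "(a, b) \<in> ranking_order (x # v) \<longleftrightarrow> (a, b) \<in> {x} \<times> set v \<union> ranking_order v"
    by (simp only: mem_ranking_order_iff ex_less_Suc_split list.size add_Suc_right add_0_right
        nth_Cons_0 nth_Cons_Suc Un_iff mem_Sigma_iff singleton_iff in_set_conv_nth) blast
qed

lemma ex_ranking_order:
  assumes "finite C" "is_vote C r"
  shows "\<exists>v. is_ranking C v \<and> ranking_order v = r"
  using assms
proof (induction "card C" arbitrary: C r)
  case 0
  then show ?case
    by (intro exI[of _ "[]"]) (auto simp: is_ranking_def is_vote_def ranking_order_def)
next
  case (Suc n)
  have sub: "r \<subseteq> C \<times> C" and tr: "trans r" and ir: "irrefl r" and tot: "total_on C r"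
    using Suc.prems by (auto simp: is_vote_def strict_linear_order_on_def)
  have "finite r"
    using sub Suc.prems(1) finite_subset by blast
  moreover have "acyclic r"
    using tr ir by (simp add: acyclic_irrefl)
  ultimately have "wf r"
    by (rule finite_acyclic_wf)
  moreover have "C \<noteq> {}"
    using Suc.hyps(2) by auto
  ultimately obtain x where x: "x \<in> C" "\<And>y. (y, x) \<in> r \<Longrightarrow> y \<notin> C"
    by (metis all_not_in_conv wfE_min)
  define C' where "C' = C - {x}"
  define r' where "r' = r \<inter> C' \<times> C'"
  have "trans r'"
    using tr unfolding r'_def trans_def by blast
  moreover have "irrefl r'" "total_on C' r'" "r' \<subseteq> C' \<times> C'"
    using ir tot by (auto simp: r'_def C'_def irrefl_def total_on_def)
  ultimately have "is_vote C' r'"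
    by (simp add: is_vote_def strict_linear_order_on_def)
  moreover have "n = card C'" "finite C'"
    using Suc x by (auto simp: C'_def)
  ultimately obtain v where v: "is_ranking C' v" "ranking_order v = r'"
    using Suc.hyps(1) by blast
  have "r = {x} \<times> C' \<union> r'"
    using sub ir tot x unfolding r'_def C'_def irrefl_def total_on_def by blast
  then have "ranking_order (x # v) = r"
    using v by (simp add: ranking_order_Cons is_ranking_def)
  moreover have "is_ranking C (x # v)"
    using v x by (auto simp: is_ranking_def C'_def)
  ultimately show ?case by blast
qed

lemma set_bin_nat: "set (bin_nat n) \<subseteq> {1, 2}"
proof (induction n rule: bin_nat.induct)
  case (1 n)
  then show ?case
    by (subst bin_nat.simps) auto
qed

lemma bin_nat_inject: "bin_nat m = bin_nat n \<Longrightarrow> m = n"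
proof (induction m arbitrary: n rule: bin_nat.induct)
  case (1 m)
  show ?case
  proof (cases "m = 0 \<or> n = 0")
    case True
    then show ?thesis
      using "1.prems" by (simp add: bin_nat.simps[of m] bin_nat.simps[of n] split: if_splits)
  next
    case False
    then have "m mod 2 = n mod 2" "bin_nat (m div 2) = bin_nat (n div 2)"
      using "1.prems" by (simp_all add: bin_nat.simps[of m] bin_nat.simps[of n])
    then show ?thesis
      using "1.IH" False by (metis div_mult_mod_eq)
  qed
qed

lemma append_sep_inject:
  assumes "xs @ a # ys = xs' @ a # ys'" "a \<notin> set xs" "a \<notin> set xs'"
  shows "xs = xs' \<and> ys = ys'"
  using assms by (induction xs arbitrary: xs') (auto simp: Cons_eq_append_conv append_eq_Cons_conv)

lemma enc_nat_append_inject: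
  assumes "enc_nat m @ ys = enc_nat n @ zs"
  shows "m = n \<and> ys = zs"
proof -
  have "3 \<notin> set (bin_nat m)" "3 \<notin> set (bin_nat n)"
    using set_bin_nat[of m] set_bin_nat[of n] by auto
  then have "bin_nat m = bin_nat n \<and> ys = zs"
    using assms append_sep_inject[of "bin_nat m" 3 ys "bin_nat n" zs] by (simp add: enc_nat_def)
  then show ?thesis
    using bin_nat_inject by blast
qed

lemma enc_nat_neq_4: "enc_nat n @ ys \<noteq> 4 # zs"
  using set_bin_nat[of n] by (cases "bin_nat n") (auto simp: enc_nat_def)

lemma enc_nats_append_inject:
  assumes "enc_nats xs @ ys = enc_nats xs' @ zs"
  shows "xs = xs' \<and> ys = zs"
  using assms
proof (induction xs arbitrary: xs')
  case Nil
  then show ?case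
    using enc_nat_neq_4[symmetric] by (cases xs') (auto simp: enc_nats_def)
next
  case (Cons x xs)
  show ?case
  proof (cases xs')
    case Nil
    then show ?thesis
      using Cons.prems enc_nat_neq_4 by (auto simp: enc_nats_def)
  next
    case (Cons x' xs'')
    then have "enc_nat x @ enc_nats xs @ ys = enc_nat x' @ enc_nats xs'' @ zs"
      using Cons.prems by (simp add: enc_nats_def)
    then show ?thesis
      using enc_nat_append_inject Cons.IH Cons by blast
  qed
qed

lemma enc_nats_neq_Nil: "enc_nats xs \<noteq> []"
  by (simp add: enc_nats_def)

lemma concat_enc_nats_inject:
  "concat (map enc_nats vs) = concat (map enc_nats vs') \<Longrightarrow> vs = vs'"
proof (induction vs arbitrary: vs')
  case Nil
  then show ?case
    by (cases vs') (auto simp: enc_nats_neq_Nil)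
next
  case (Cons v vs)
  then show ?case
    by (cases vs') (auto simp: enc_nats_neq_Nil dest: enc_nats_append_inject)
qed

lemma enc_winner_inject:
  "enc_winner cs vs p = enc_winner cs' vs' p' \<longleftrightarrow> cs = cs' \<and> vs = vs' \<and> p = p'"
proof
  assume "enc_winner cs vs p = enc_winner cs' vs' p'"
  then have "enc_nat p @ (enc_nats cs @ concat (map enc_nats vs)) =
      enc_nat p' @ (enc_nats cs' @ concat (map enc_nats vs'))"
    by (simp only: enc_winner_def)
  from enc_nat_append_inject[OF this] have p: "p = p'"
    and "enc_nats cs @ concat (map enc_nats vs) = enc_nats cs' @ concat (map enc_nats vs')"
    by blast+
  from enc_nats_append_inject[OF this(2)] p show "cs = cs' \<and> vs = vs' \<and> p = p'"
    by (simp add: concat_enc_nats_inject)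
qed simp

lemma enc_conformant_inject:
  "enc_conformant cs vs w p = enc_conformant cs' vs' w' p' \<longleftrightarrow>
     cs = cs' \<and> vs = vs' \<and> w = w' \<and> p = p'"
proof
  assume "enc_conformant cs vs w p = enc_conformant cs' vs' w' p'"
  then have eq: "replicate w 3 @ 4 # enc_winner cs vs p = replicate w' 3 @ 4 # enc_winner cs' vs' p'"
    by (simp only: enc_conformant_def append.simps)
  have "4 \<notin> set (replicate n (3::nat))" for n
    by simp
  from append_sep_inject[OF eq this this]
  have "replicate w (3::nat) = replicate w' 3" "enc_winner cs vs p = enc_winner cs' vs' p'"
    by blast+
  then show "cs = cs' \<and> vs = vs' \<and> w = w' \<and> p = p'"
    unfolding enc_winner_inject by (metis length_replicate)
qed simp

end

theory Submission
  imports Defs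
begin

text \<open>
  A conformant manipulation by \<open>k + 1\<close> voters consists of one vote \<open>v\<close> from \<open>V\<close> followed by a conformant
  manipulation by \<open>k\<close> voters of the election with \<open>v\<close> added, since adding \<open>v\<close> does not change the set of
  available votes. On encodings, adding \<open>v\<close> means appending one more copy of a block of the input
  that lies between two list terminators 4. The class P is closed under the corresponding operation
  on languages, because an input has only linearly many blocks and they can be tried one by one;
  applying it \<open>k\<close> times to the winner problem gives the theorem.
\<close>

section \<open>Runs of Turing machines\<close>

text \<open>Since the votes of manipulators are copied from \<open>V\<close>, extending the election
  is pure string copying: no machine has to build or parse a ranking. Apart from its last symbol,
  the form of the input is not checked either. The decider of the smaller problem sees the extended
  string, and if that is an encoding, then so is the string before the appended block. Each use of
  the closure operation turns a time bound p(n) into roughly (n + 1) * p(2 n), as there are at most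
  n blocks and each is shorter than the input. This stays polynomial under a fixed number k of
  iterations. The main obstacle is on the machine side: one decider runs many times on the same
  tapes, so what it touched must be located and wiped between runs.\<close>

definition reaches :: "turing_machine \<Rightarrow> nat \<Rightarrow> tm_config \<Rightarrow> tm_config \<Rightarrow> bool" where
  "reaches M n c c' \<longleftrightarrow> (\<exists>t\<le>n. (tm_step M ^^ t) c = c')"

lemma reaches_refl: "reaches M n c c"
  unfolding reaches_def by (rule exI[of _ 0]) simp

lemma reaches_trans:
  assumes "reaches M m c c'" "reaches M n c' c''"
  shows "reaches M (m + n) c c''"
proof -
  obtain s t where "s \<le> m" "t \<le> n" "(tm_step M ^^ s) c = c'" "(tm_step M ^^ t) c' = c''"
    using assms unfolding reaches_def by blast
  then have "t + s \<le> m + n" "(tm_step M ^^ (t + s)) c = c''"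
    by (simp_all add: funpow_add)
  then show ?thesis
    unfolding reaches_def by blast
qed

lemma reaches_mono: "reaches M m c c' \<Longrightarrow> m \<le> n \<Longrightarrow> reaches M n c c'"
  unfolding reaches_def using le_trans by blast

lemma reaches_step: "reaches M 1 c (tm_step M c)"
  unfolding reaches_def by (rule exI[of _ 1]) simp

lemma reaches_Suc:
  assumes "tm_step M c = c'" "reaches M n c' c''"
  shows "reaches M (Suc n) c c''"
  using reaches_trans[OF reaches_step assms(2)[folded assms(1)]] by simp

lemma funpow_tm_step_halted:
  assumes "q = accept_state M \<or> q = reject_state M"
  shows "(tm_step M ^^ t) (q, ts) = (q, ts)"
  using assms by (induction t) auto

text \<open>\<open>wf_turing_machine\<close> controls \<open>transition\<close> only on states and
  symbols in range. This invariant keeps runs of \<open>M\<close> inside that range, hence away from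
  the fresh state of \<open>cons_machine\<close>.\<close>

fun tm_config_ok :: "turing_machine \<Rightarrow> tm_config \<Rightarrow> bool" where
  "tm_config_ok M (q, ts) \<longleftrightarrow>
     q < num_states M \<and> length ts = num_tapes M \<and> (\<forall>t \<in> set ts. \<forall>i. t i < num_symbols M)"

lemma act_tape_cell_less:
  assumes "\<forall>i. t i < G" "s < G"
  shows "act_tape (s, m) t i < G"
  using assms by (cases m) auto

lemma wf_transition:
  assumes "wf_turing_machine M" "q < num_states M" "length ss = num_tapes M"
    and "set ss \<subseteq> {..<num_symbols M}" "transition M q ss = (q', acts)"
  shows "q' < num_states M" "length acts = num_tapes M"
    and "\<And>s m. (s, m) \<in> set acts \<Longrightarrow> s < num_symbols M"
  using assms unfolding wf_turing_machine_def by fastforce+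

lemma tm_config_ok_step:
  assumes "wf_turing_machine M" "tm_config_ok M c"
  shows "tm_config_ok M (tm_step M c)"
proof -
  obtain q ts where c: "c = (q, ts)" by (cases c)
  show ?thesis
  proof (cases "q = accept_state M \<or> q = reject_state M")
    case True
    then show ?thesis using assms c by auto
  next
    case False
    obtain q' acts where tr: "transition M q (map (\<lambda>t. t 0) ts) = (q', acts)"
      by (cases "transition M q (map (\<lambda>t. t 0) ts)")
    have ok: "q < num_states M" "length (map (\<lambda>t. t 0) ts) = num_tapes M"
      "set (map (\<lambda>t. t 0) ts) \<subseteq> {..<num_symbols M}"
      using assms(2) c by auto
    note wf = wf_transition[OF assms(1) ok tr]
    have "\<forall>t \<in> set (map2 act_tape acts ts). \<forall>i. t i < num_symbols M"
    proof (intro ballI allI)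
      fix t i assume "t \<in> set (map2 act_tape acts ts)"
      then obtain s m u where "(s, m) \<in> set acts" "u \<in> set ts" "t = act_tape (s, m) u"
        by (force dest: set_zip_leftD set_zip_rightD)
      then show "t i < num_symbols M"
        using wf(3) assms(2) c act_tape_cell_less by auto
    qed
    then show ?thesis
      using False tr wf assms(2) c by auto
  qed
qed

lemma tm_config_ok_init:
  assumes "wf_turing_machine M" "\<sigma> < num_symbols M" "x \<in> lists {1..\<sigma>}"
  shows "tm_config_ok M (tm_init M x)"
proof -
  have "input_tape x i < num_symbols M" for i
  proof (cases "0 \<le> i \<and> i < int (length x)")
    case True
    then have "x ! nat i \<in> set x" by (intro nth_mem) auto
    then show ?thesis using assms True by (auto simp: input_tape_def)
  qed (use assms in \<open>auto simp: input_tape_def\<close>)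
  then show ?thesis
    using assms by (auto simp: tm_init_def wf_turing_machine_def blank_tape_def)
qed

lemma decides_in_timeD:
  assumes "decides_in_time M \<sigma> L T" "x \<in> lists {1..\<sigma>}"
  obtains t where "t \<le> T (length x)"
    and "fst ((tm_step M ^^ t) (tm_init M x)) = (if x \<in> L then accept_state M else reject_state M)"
  using assms unfolding decides_in_time_def by blast

lemma map2_act_tape_Stay: "map2 act_tape (map (\<lambda>t. (t 0, Stay)) ts) ts = ts"
  by (induction ts) auto


lemma poly_nat_mono:
  fixes p :: "nat poly"
  assumes "x \<le> y"
  shows "poly p x \<le> poly p y"
  using assms by (induction p) (auto intro!: add_mono mult_mono)


section \<open>Prefixing a fixed symbol\<close>

text \<open>The fresh start state checks the first symbol, erases it and steps right. As tapes are
  stored relative to the head, this leaves exactly the initial configuration of \<open>M\<close> on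
  the remaining input, at the price of one step.\<close>

definition cons_machine :: "nat \<Rightarrow> turing_machine \<Rightarrow> turing_machine" where
  "cons_machine a M = M
     \<lparr>num_states := Suc (num_states M), start_state := num_states M,
      transition := \<lambda>q ss. if q = num_states M
        then (if hd ss = a then (start_state M, (0, Move_Right) # map (\<lambda>s. (s, Stay)) (tl ss))
              else (reject_state M, map (\<lambda>s. (s, Stay)) ss))
        else transition M q ss\<rparr>"

lemma cons_machine_step:
  assumes "fst c < num_states M"
  shows "tm_step (cons_machine a M) c = tm_step M c"
  using assms by (cases c) (auto simp: cons_machine_def)

lemma cons_machine_run:
  assumes "wf_turing_machine M" "tm_config_ok M c"
  shows "(tm_step (cons_machine a M) ^^ t) c = (tm_step M ^^ t) c \<and>
    tm_config_ok M ((tm_step M ^^ t) c)"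
proof (induction t)
  case (Suc t)
  then have "tm_config_ok M (tm_step M ((tm_step M ^^ t) c))"
    using assms(1) tm_config_ok_step by blast
  moreover have "fst ((tm_step M ^^ t) c) < num_states M"
    using Suc by (cases "(tm_step M ^^ t) c") auto
  ultimately show ?case
    using Suc cons_machine_step by simp
qed (use assms in simp)

lemma input_tape_Cons: "act_tape (0, Move_Right) (input_tape (a # y)) = input_tape y"
  by (rule ext) (auto simp: input_tape_def nat_add_distrib)

lemma wf_cons_machine:
  assumes "wf_turing_machine M" "0 < num_symbols M"
  shows "wf_turing_machine (cons_machine a M)"
proof -
  have tr: "case transition (cons_machine a M) q ss of (q', acts) \<Rightarrow>
      q' < Suc (num_states M) \<and> length acts = num_tapes M \<and>
      (\<forall>(s, m) \<in> set acts. s < num_symbols M)"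
    if "q < Suc (num_states M)" "length ss = num_tapes M" "set ss \<subseteq> {..<num_symbols M}" for q ss
  proof (cases "q = num_states M")
    case True
    have "ss \<noteq> []"
      using assms(1) that by (auto simp: wf_turing_machine_def)
    then have "length ss = Suc (length (tl ss))" "set (tl ss) \<subseteq> set ss"
      by (cases ss; auto)+
    then show ?thesis
      using True assms that by (auto simp: wf_turing_machine_def cons_machine_def)
  next
    case False
    then have "q < num_states M" using that by simp
    from wf_transition[OF assms(1) this that(2,3)] show ?thesis
      using False
      by (cases "transition M q ss") (fastforce simp: cons_machine_def)
  qed
  show ?thesis
    unfolding wf_turing_machine_def using assms(1) tr
    by (auto simp: wf_turing_machine_def cons_machine_def)
qed

text \<open>The disjunct with \<open>a = 0\<close> arises because an empty input shows the blank 0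
  under the head; letters of the input alphabet exclude it.\<close>

lemma cons_machine_init_step:
  assumes "wf_turing_machine M"
  shows "tm_step (cons_machine a M) (tm_init (cons_machine a M) x) =
    (if x \<noteq> [] \<and> hd x = a \<or> x = [] \<and> a = 0 then
       (start_state M, act_tape (0, Move_Right) (input_tape x) # replicate (num_tapes M - 1) blank_tape)
     else (reject_state M, input_tape x # replicate (num_tapes M - 1) blank_tape))"
proof -
  have [simp]: "input_tape x 0 = (if x = [] then 0 else hd x)"
    by (auto simp: input_tape_def hd_conv_nth)
  have ne: "num_states M \<noteq> accept_state M" "num_states M \<noteq> reject_state M"
    using assms by (auto simp: wf_turing_machine_def)
  have "map2 act_tape (map (\<lambda>s. (s, Stay)) (replicate n (blank_tape 0))) (replicate n blank_tape) =
      replicate n blank_tape" for n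
    using map2_act_tape_Stay[of "replicate n blank_tape"] by (simp add: map_replicate_const)
  then show ?thesis
    using ne by (auto simp: cons_machine_def tm_init_def fun_upd_idem)
qed

lemma class_P_Cons:
  assumes "L \<in> class_P \<sigma>" "a \<in> {1..\<sigma>}"
  shows "Cons a ` L \<in> class_P \<sigma>"
proof -
  obtain M and p :: "nat poly" where dec: "decides_in_time M \<sigma> L (poly p)"
    using assms(1) by (auto simp: class_P_def)
  then have wf: "wf_turing_machine M" and \<sigma>: "\<sigma> < num_symbols M" and L: "L \<subseteq> lists {1..\<sigma>}"
    by (auto simp: decides_in_time_def)
  let ?M = "cons_machine a M"
  have [simp]: "accept_state ?M = accept_state M" "reject_state ?M = reject_state M"
    "num_symbols ?M = num_symbols M"
    by (simp_all add: cons_machine_def)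
  have "\<exists>t \<le> poly (p + 1) (length x). fst ((tm_step ?M ^^ t) (tm_init ?M x)) =
      (if x \<in> Cons a ` L then accept_state ?M else reject_state ?M)"
    if x: "x \<in> lists {1..\<sigma>}" for x
  proof (cases "x \<noteq> [] \<and> hd x = a")
    case True
    then obtain y where y: "x = a # y" by (cases x) auto
    with x have y\<sigma>: "y \<in> lists {1..\<sigma>}" by simp
    from decides_in_timeD[OF dec this] obtain t where t: "t \<le> poly p (length y)"
      "fst ((tm_step M ^^ t) (tm_init M y)) = (if y \<in> L then accept_state M else reject_state M)"
      by blast
    have "tm_step ?M (tm_init ?M x) = tm_init M y"
      unfolding cons_machine_init_step[OF wf] using y
      by (simp add: input_tape_Cons tm_init_def del: act_tape.simps)
    then have "(tm_step ?M ^^ Suc t) (tm_init ?M x) = (tm_step M ^^ t) (tm_init M y)"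
      using cons_machine_run[OF wf tm_config_ok_init[OF wf \<sigma> y\<sigma>]]
      by (simp add: funpow_Suc_right del: funpow.simps)
    \<comment> \<open>The decider is bounded in terms of the shorter input \<open>y\<close>; the
      step spent on the check is the \<open>+ 1\<close> of the new polynomial.\<close>
    moreover have "poly p (length y) \<le> poly p (length x)"
      using y by (intro poly_nat_mono) simp
    ultimately show ?thesis
      using t y by (intro exI[of _ "Suc t"]) (auto simp del: funpow.simps)
  next
    case False
    then have "x \<notin> Cons a ` L" by auto
    moreover have "fst ((tm_step ?M ^^ 1) (tm_init ?M x)) = reject_state M"
      using False assms(2) cons_machine_init_step[OF wf, of a x] by auto
    ultimately show ?thesis
      by (intro exI[of _ 1]) simp
  qed
  then have "decides_in_time ?M \<sigma> (Cons a ` L) (poly (p + 1))"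
    using wf_cons_machine[OF wf] \<sigma> L assms(2) unfolding decides_in_time_def
    by (intro conjI ballI) (auto 0 3)
  then show ?thesis
    unfolding class_P_def by blast
qed


section \<open>Appending an inner block\<close>

text \<open>Neighbouring blocks share a terminator. Requiring two of them excludes an unfinished
  tail and also the part before the first 4, which in an encoding holds the preferred candidate and
  the candidate list.\<close>

definition inner_blocks :: "nat list \<Rightarrow> nat list set" where
  "inner_blocks x = {b. 4 \<notin> set b \<and> (\<exists>u v. x = u @ 4 # b @ 4 # v)}"

lemma inner_blocks_append:
  assumes "4 \<notin> set c"
  shows "inner_blocks (c @ 4 # r) = inner_blocks (4 # r)"
proof (intro equalityI subsetI)
  fix b assume "b \<in> inner_blocks (c @ 4 # r)"
  then obtain u v where b: "4 \<notin> set b" and eq: "c @ 4 # r = u @ 4 # b @ 4 # v"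
    by (auto simp: inner_blocks_def)
  from eq obtain us where "c = u @ us \<and> us @ 4 # r = 4 # b @ 4 # v \<or> c @ us = u \<and> 4 # r = us @ 4 # b @ 4 # v"
    by (auto simp: append_eq_append_conv2)
  then show "b \<in> inner_blocks (4 # r)"
  proof
    assume *: "c = u @ us \<and> us @ 4 # r = 4 # b @ 4 # v"
    then have "us = []" using assms by (cases us) auto
    with * have "4 # r = [] @ 4 # b @ 4 # v" by simp
    with b show ?thesis unfolding inner_blocks_def by blast
  qed (use b in \<open>unfold inner_blocks_def, blast\<close>)
next
  fix b assume "b \<in> inner_blocks (4 # r)"
  then obtain u v where "4 \<notin> set b" "4 # r = u @ 4 # b @ 4 # v"
    by (auto simp: inner_blocks_def)
  then have "4 \<notin> set b" "c @ 4 # r = (c @ u) @ 4 # b @ 4 # v" by simp_all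
  then show "b \<in> inner_blocks (c @ 4 # r)" unfolding inner_blocks_def by blast
qed

text \<open>The leading 4 stands for the terminator just passed, so this recursion peels off one
  block at a time, as the searcher does on its second tape.\<close>

lemma inner_blocks_Cons:
  assumes "4 \<notin> set b"
  shows "inner_blocks (4 # b @ 4 # r) = insert b (inner_blocks (4 # r))"
proof (intro equalityI subsetI)
  fix c assume "c \<in> inner_blocks (4 # b @ 4 # r)"
  then obtain u v where c: "4 \<notin> set c" "4 # b @ 4 # r = u @ 4 # c @ 4 # v"
    by (auto simp: inner_blocks_def)
  show "c \<in> insert b (inner_blocks (4 # r))"
  proof (cases u)
    case Nil
    then show ?thesis using c assms append_sep_inject by fastforce
  next
    case (Cons d u')
    then have "b @ 4 # r = u' @ 4 # c @ 4 # v" using c by simp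
    then have "c \<in> inner_blocks (b @ 4 # r)"
      unfolding inner_blocks_def using c(1) by blast
    then show ?thesis using inner_blocks_append[OF assms] by simp
  qed
next
  fix c assume "c \<in> insert b (inner_blocks (4 # r))"
  then show "c \<in> inner_blocks (4 # b @ 4 # r)"
  proof
    assume "c = b"
    then have "4 # b @ 4 # r = [] @ 4 # c @ 4 # r" by simp
    then show ?thesis unfolding inner_blocks_def using \<open>c = b\<close> assms by blast
  next
    assume "c \<in> inner_blocks (4 # r)"
    then have "c \<in> inner_blocks (b @ 4 # r)" using inner_blocks_append[OF assms] by simp
    then obtain u v where "4 \<notin> set c" "b @ 4 # r = u @ 4 # c @ 4 # v"
      by (auto simp: inner_blocks_def)
    then have "4 \<notin> set c" "4 # b @ 4 # r = (4 # u) @ 4 # c @ 4 # v" by simp_all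
    then show ?thesis unfolding inner_blocks_def by blast
  qed
qed

lemma inner_blocks_none:
  assumes "4 \<notin> set r"
  shows "inner_blocks (4 # r) = {}"
  using assms unfolding inner_blocks_def by (auto simp: Cons_eq_append_conv)

lemma inner_blocks_concat:
  assumes "\<And>v. v \<in> set vs \<Longrightarrow> 4 \<notin> set (f v)"
  shows "inner_blocks (4 # concat (map (\<lambda>v. f v @ [4]) vs)) = f ` set vs"
  using assms
proof (induction vs)
  case (Cons v vs)
  then show ?case using inner_blocks_Cons[of "f v" "concat (map (\<lambda>v. f v @ [4]) vs)"] by simp
qed (simp add: inner_blocks_none)

text \<open>\<open>last x = 4\<close> keeps the appended \<open>b\<close> a block of its own;
  otherwise it would merge with an unfinished tail of \<open>x\<close>.\<close>

definition appending_inner_block :: "nat list set \<Rightarrow> nat list set" where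
  "appending_inner_block L =
     {x \<in> lists {1..4}. x \<noteq> [] \<and> last x = 4 \<and> (\<exists>b \<in> inner_blocks x. x @ b @ [4] \<in> L)}"


section \<open>Conformant manipulation with one more manipulator\<close>

text \<open>With \<open>k\<close> as a parameter, instances have the same shape for every
  \<open>k\<close>, that of a winner instance, so the induction on \<open>k\<close> stays within
  \<open>winner_language\<close>.\<close>

definition conformant_winner_problem :: "rule \<Rightarrow> nat \<Rightarrow> (cand set \<times> vote multiset \<times> cand) set" where
  "conformant_winner_problem E k = {(C, V, p). (C, V, k, p) \<in> conformant_manipulation E}"

lemma conformant_winner_problem_0: "conformant_winner_problem E 0 = winner_problem E"
  by (auto simp: conformant_winner_problem_def conformant_manipulation_def winner_problem_def)

lemma conformant_winner_problem_Suc: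
  "(C, V, p) \<in> conformant_winner_problem E (Suc k) \<longleftrightarrow>
     (\<exists>r \<in># V. (C, add_mset r V, p) \<in> conformant_winner_problem E k)"
proof
  assume "(C, V, p) \<in> conformant_winner_problem E (Suc k)"
  then obtain ws where el: "is_election C V" "p \<in> C" and ws: "length ws = Suc k"
    "set ws \<subseteq> set_mset V" "p \<in> E C (V + mset ws)"
    by (auto simp: conformant_winner_problem_def conformant_manipulation_def)
  then obtain r ws' where "ws = r # ws'" by (cases ws) auto
  with el ws have "r \<in># V" "is_election C (add_mset r V)" "length ws' = k"
    "set ws' \<subseteq> set_mset (add_mset r V)" "p \<in> E C (add_mset r V + mset ws')"
    by (auto simp: is_election_def)
  with el(2) show "\<exists>r \<in># V. (C, add_mset r V, p) \<in> conformant_winner_problem E k"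
    by (auto simp: conformant_winner_problem_def conformant_manipulation_def
        simp del: union_mset_add_mset_left)
next
  assume "\<exists>r \<in># V. (C, add_mset r V, p) \<in> conformant_winner_problem E k"
  then obtain r ws where r: "r \<in># V" "is_election C (add_mset r V)" "p \<in> C" "length ws = k"
    "set ws \<subseteq> set_mset (add_mset r V)" "p \<in> E C (add_mset r V + mset ws)"
    by (auto simp: conformant_winner_problem_def conformant_manipulation_def
        simp del: union_mset_add_mset_left)
  then have "is_election C V" "length (r # ws) = Suc k" "set (r # ws) \<subseteq> set_mset V"
    "p \<in> E C (V + mset (r # ws))"
    by (auto simp: is_election_def)
  with r(3) show "(C, V, p) \<in> conformant_winner_problem E (Suc k)"
    unfolding conformant_winner_problem_def conformant_manipulation_def by blast
qed

text \<open>For fixed \<open>k\<close> the explicit list of manipulators is a constant prefix, so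
  closure under prefixing a symbol bridges the two encodings.\<close>

lemma conformant_language_eq:
  "conformant_language {(C, V, w, p). (C, V, w, p) \<in> conformant_manipulation E \<and> w = k} =
     (\<lambda>x. replicate k 3 @ 4 # x) ` winner_language (conformant_winner_problem E k)"
proof (intro equalityI subsetI)
  fix y assume "y \<in> conformant_language {(C, V, w, p). (C, V, w, p) \<in> conformant_manipulation E \<and> w = k}"
  then obtain cs vs p where "y = replicate k 3 @ 4 # enc_winner cs vs p" "distinct cs"
    "\<forall>v \<in> set vs. is_ranking (set cs) v"
    "(set cs, mset (map ranking_order vs), p) \<in> conformant_winner_problem E k"
    unfolding conformant_language_def conformant_winner_problem_def enc_conformant_def
    by (auto simp del: mset_map)
  then show "y \<in> (\<lambda>x. replicate k 3 @ 4 # x) ` winner_language (conformant_winner_problem E k)"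
    unfolding winner_language_def by blast
next
  fix y assume "y \<in> (\<lambda>x. replicate k 3 @ 4 # x) ` winner_language (conformant_winner_problem E k)"
  then obtain cs vs p where *: "y = replicate k 3 @ [4] @ enc_winner cs vs p" "distinct cs"
    "\<forall>v \<in> set vs. is_ranking (set cs) v"
    "(set cs, mset (map ranking_order vs), k, p) \<in> conformant_manipulation E"
    unfolding winner_language_def conformant_winner_problem_def by (auto simp del: mset_map)
  show "y \<in> conformant_language {(C, V, w, p). (C, V, w, p) \<in> conformant_manipulation E \<and> w = k}"
    unfolding conformant_language_def enc_conformant_def
    by (intro CollectI exI[of _ cs] exI[of _ vs] exI[of _ k] exI[of _ p]) (use * in simp)
qed

section \<open>Encodings as sequences of blocks\<close>

definition nat_codes :: "nat list \<Rightarrow> nat list" where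
  "nat_codes v = concat (map enc_nat v)"

lemma set_nat_codes: "set (nat_codes v) \<subseteq> {1, 2, 3}"
proof -
  have "set (enc_nat n) \<subseteq> {1, 2, 3}" for n
    using set_bin_nat[of n] by (auto simp: enc_nat_def)
  then show ?thesis
    unfolding nat_codes_def by fastforce
qed

lemma four_notin_nat_codes: "4 \<notin> set (nat_codes v)"
  using set_nat_codes[of v] by auto

lemma enc_nats_eq: "enc_nats v = nat_codes v @ [4]"
  by (simp add: enc_nats_def nat_codes_def)

lemma nat_codes_inject: "nat_codes v = nat_codes v' \<Longrightarrow> v = v'"
  using enc_nats_append_inject[of v "[]" v' "[]"] by (simp add: enc_nats_eq)

text \<open>\<open>enc_nat p\<close> contains no 4, so \<open>p\<close> shares a block with the
  candidate list, and the blocks enclosed by terminators are exactly the votes.\<close>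

lemma enc_winner_eq:
  "enc_winner cs vs p = nat_codes (p # cs) @ 4 # concat (map (\<lambda>v. nat_codes v @ [4]) vs)"
  unfolding enc_winner_def enc_nats_eq by (simp add: nat_codes_def)

lemma enc_winner_snoc: "enc_winner cs (vs @ [v]) p = enc_winner cs vs p @ nat_codes v @ [4]"
  by (simp add: enc_winner_eq)

lemma last_enc_winner: "enc_winner cs vs p \<noteq> [] \<and> last (enc_winner cs vs p) = 4"
  by (cases vs rule: rev_cases) (simp_all add: enc_winner_eq)

lemma enc_winner_in_lists: "enc_winner cs vs p \<in> lists {1..4}"
proof -
  have "set (nat_codes v) \<subseteq> {1..4}" for v
    using set_nat_codes[of v] by auto
  then show ?thesis
    unfolding enc_winner_eq lists_eq_set by auto
qed

lemma inner_blocks_enc_winner: "inner_blocks (enc_winner cs vs p) = nat_codes ` set vs"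
  unfolding enc_winner_eq
  by (simp add: inner_blocks_append four_notin_nat_codes inner_blocks_concat)

text \<open>The mirror image of \<open>append_sep_inject\<close>, cutting at the last separator:
  \<open>x\<close> has earlier 4s, while the appended block has none.\<close>

lemma append_sep_last_inject:
  assumes "xs @ a # ys = xs' @ a # ys'" "a \<notin> set ys" "a \<notin> set ys'"
  shows "xs = xs' \<and> ys = ys'"
proof -
  have "rev ys @ a # rev xs = rev ys' @ a # rev xs'"
    using arg_cong[OF assms(1), of rev] by simp
  then show ?thesis
    using append_sep_inject[of "rev ys" a "rev xs" "rev ys'" "rev xs'"] assms by simp
qed

text \<open>As \<open>b\<close> has no 4, the last but one 4 of \<open>x @ b @ [4]\<close> is the
  end of \<open>x\<close>. Cutting there strips the last vote off the encoding, and \<open>b\<close>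
  being an inner block of \<open>x\<close> makes this vote one of the others.\<close>

lemma enc_winner_appendD:
  assumes "x \<noteq> []" "last x = 4" "b \<in> inner_blocks x" "x @ b @ [4] = enc_winner cs vs p"
  obtains us v where "vs = us @ [v]" "b = nat_codes v" "x = enc_winner cs us p" "v \<in> set us"
proof -
  obtain x' where x': "x = x' @ [4]"
    using assms(1,2) by (metis append_butlast_last_id)
  have b: "4 \<notin> set b"
    using assms(3) by (auto simp: inner_blocks_def)
  show ?thesis
  proof (cases vs rule: rev_cases)
    case Nil
    \<comment> \<open>An encoding without votes has a single 4, but \<open>x\<close> and the final
      \<open>[4]\<close> supply two.\<close>
    then have "x' @ 4 # b = nat_codes (p # cs)"
      using assms(4) x' by (simp add: enc_winner_eq)
    then have "4 \<in> set (nat_codes (p # cs))"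
      by (metis in_set_conv_decomp)
    then show ?thesis
      using four_notin_nat_codes by blast
  next
    case (snoc us v)
    obtain y where y: "enc_winner cs us p = y @ [4]"
      using last_enc_winner[of cs us p] by (metis append_butlast_last_id)
    have "x' @ 4 # b = y @ 4 # nat_codes v"
      using assms(4) x' y snoc by (simp add: enc_winner_snoc)
    from append_sep_last_inject[OF this b four_notin_nat_codes]
    have *: "x = enc_winner cs us p" "b = nat_codes v"
      using x' y by simp_all
    then have "nat_codes v \<in> nat_codes ` set us"
      using assms(3) inner_blocks_enc_winner by simp
    then have "v \<in> set us"
      using nat_codes_inject by blast
    then show ?thesis
      using that snoc * by blast
  qed
qed

lemma winner_language_conformant_Suc:
  "winner_language (conformant_winner_problem E (Suc k)) =
     appending_inner_block (winner_language (conformant_winner_problem E k))"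
proof (intro equalityI subsetI)
  fix x assume "x \<in> winner_language (conformant_winner_problem E (Suc k))"
  then obtain cs vs p where x: "x = enc_winner cs vs p" and cs: "distinct cs"
    and vs: "\<forall>v \<in> set vs. is_ranking (set cs) v"
    and yes: "(set cs, mset (map ranking_order vs), p) \<in> conformant_winner_problem E (Suc k)"
    unfolding winner_language_def by blast
  from yes obtain v where v: "v \<in> set vs"
    "(set cs, mset (map ranking_order (vs @ [v])), p) \<in> conformant_winner_problem E k"
    unfolding conformant_winner_problem_Suc by auto
  then have "enc_winner cs (vs @ [v]) p \<in> winner_language (conformant_winner_problem E k)"
    unfolding winner_language_def using cs vs v(1)
    by (intro CollectI exI[of _ cs] exI[of _ "vs @ [v]"] exI[of _ p] conjI refl) auto
  moreover have "nat_codes v \<in> inner_blocks x"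
    using v(1) x inner_blocks_enc_winner by simp
  ultimately show "x \<in> appending_inner_block (winner_language (conformant_winner_problem E k))"
    unfolding appending_inner_block_def using x enc_winner_in_lists last_enc_winner
    by (auto simp: enc_winner_snoc simp del: lists_eq_set)
next
  fix x assume "x \<in> appending_inner_block (winner_language (conformant_winner_problem E k))"
  then obtain b cs vs p where x: "x \<noteq> []" "last x = 4" "b \<in> inner_blocks x"
    "x @ b @ [4] = enc_winner cs vs p" and cs: "distinct cs"
    and vs: "\<forall>v \<in> set vs. is_ranking (set cs) v"
    and yes: "(set cs, mset (map ranking_order vs), p) \<in> conformant_winner_problem E k"
    unfolding appending_inner_block_def winner_language_def by blast
  from enc_winner_appendD[OF x] obtain us v where us: "vs = us @ [v]" "x = enc_winner cs us p"
    "v \<in> set us"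
    by blast
  then have "(set cs, mset (map ranking_order us), p) \<in> conformant_winner_problem E (Suc k)"
    unfolding conformant_winner_problem_Suc using yes by auto
  then show "x \<in> winner_language (conformant_winner_problem E (Suc k))"
    unfolding winner_language_def using us cs vs
    by (intro CollectI exI[of _ cs] exI[of _ us] exI[of _ p]) simp
qed

section \<open>Searching for an inner block\<close>

text \<open>\<open>zipper ls rs\<close> is the tape with contents \<open>rev ls @ rs\<close> whose head is on the first symbol of \<open>rs\<close>.\<close>

definition zipper :: "nat list \<Rightarrow> nat list \<Rightarrow> tape" where
  "zipper ls rs = (\<lambda>i. if 0 \<le> i then if nat i < length rs then rs ! nat i else 0
     else if nat (- i - 1) < length ls then ls ! nat (- i - 1) else 0)"

lemma zipper_int [simp]:
  "zipper ls rs (int n) = (if n < length rs then rs ! n else 0)"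
  "zipper ls rs (- 1 - int n) = (if n < length ls then ls ! n else 0)"
  by (simp_all add: zipper_def)

lemma zipper_head [simp]:
  "zipper ls (a # rs) 0 = a" "zipper ls [] 0 = 0"
  "zipper (c # ls) rs (- 1) = c" "zipper [] rs (- 1) = 0"
  by (simp_all add: zipper_def)

text \<open>Splitting the cells into \<open>int n\<close> and \<open>- 1 - int n\<close> turns both
  halves of a tape into lists indexed by naturals, so zipper equations become case distinctions on
  \<open>n\<close>.\<close>

lemma tape_eqI:
  fixes t u :: tape
  assumes "\<And>n. t (int n) = u (int n)" "\<And>n. t (- 1 - int n) = u (- 1 - int n)"
  shows "t = u"
proof
  fix i
  show "t i = u i"
  proof (cases "0 \<le> i")
    case True
    then show ?thesis using assms(1)[of "nat i"] by simp
  next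
    case False
    then show ?thesis using assms(2)[of "nat (- 1 - i)"] by simp
  qed
qed

lemma act_tape_Right_int:
  "act_tape (b, Move_Right) t (int n) = t (int (Suc n))"
  "act_tape (b, Move_Right) t (- 1 - int n) = (case n of 0 \<Rightarrow> b | Suc m \<Rightarrow> t (- 1 - int m))"
  by (auto simp: add.commute split: nat.split)

lemma act_tape_Left_int:
  "act_tape (b, Move_Left) t (int n) =
     (case n of 0 \<Rightarrow> t (- 1 - int 0) | Suc 0 \<Rightarrow> b | Suc (Suc m) \<Rightarrow> t (int (Suc m)))"
  "act_tape (b, Move_Left) t (- 1 - int n) = t (- 1 - int (Suc n))"
  by (auto simp: algebra_simps split: nat.split)

lemma act_tape_Stay [simp]: "b = t 0 \<Longrightarrow> act_tape (b, Stay) t = t"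
  by auto

lemma act_tape_Stay_int:
  "act_tape (b, Stay) t (int n) = (case n of 0 \<Rightarrow> b | Suc m \<Rightarrow> t (int (Suc m)))"
  "act_tape (b, Stay) t (- 1 - int n) = t (- 1 - int n)"
  by (auto split: nat.split)

lemmas act_tape_int = act_tape_Right_int act_tape_Left_int act_tape_Stay_int

declare act_tape.simps [simp del] of_nat_Suc [simp del]

lemma zipper_Right [simp]:
  "act_tape (b, Move_Right) (zipper ls (a # rs)) = zipper (b # ls) rs"
  "act_tape (b, Move_Right) (zipper ls []) = zipper (b # ls) []"
  by (rule tape_eqI; simp add: act_tape_int split: nat.split)+

lemma zipper_Left [simp]:
  "act_tape (b, Move_Left) (zipper (c # ls) (a # rs)) = zipper ls (c # b # rs)"
  "act_tape (b, Move_Left) (zipper [] (a # rs)) = zipper [] (0 # b # rs)"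
  "act_tape (0, Move_Left) (zipper (c # ls) []) = zipper ls [c]"
  "act_tape (0, Move_Left) (zipper [] []) = zipper [] []"
  by (rule tape_eqI; simp add: act_tape_int split: nat.split)+

lemma zipper_Stay [simp]:
  "act_tape (b, Stay) (zipper ls (a # rs)) = zipper ls (b # rs)"
  "act_tape (b, Stay) (zipper ls []) = zipper ls [b]"
  by (rule tape_eqI; simp add: act_tape_int split: nat.split)+

declare of_nat_Suc [simp]

text \<open>Stepping off the left end and back, or rewriting a blank at the right end, leaves a
  blank entry in the zipper; these rules remove it.\<close>

lemma zipper_blank [simp]: "zipper [0] rs = zipper [] rs" "zipper ls [0] = zipper ls []"
  by (rule tape_eqI; simp)+

lemma input_tape_eq_zipper: "input_tape x = zipper [] x"
  by (rule ext) (auto simp: input_tape_def zipper_def)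

lemma blank_tape_eq_zipper: "blank_tape = zipper [] []"
  by (rule ext) (auto simp: blank_tape_def zipper_def)

lemma map2_map_same [simp]: "map2 f (map h ts) ts = map (\<lambda>t. f (h t) t) ts"
  by (induction ts) auto

section \<open>Intervals of nonzero cells\<close>

text \<open>Positions are relative to the head. Erasing depends only on which cells are nonzero, so
  the symbols themselves are forgotten.\<close>

definition segment :: "int \<Rightarrow> int \<Rightarrow> tape \<Rightarrow> bool" where
  "segment a b t \<longleftrightarrow> (\<forall>i. t i \<noteq> 0 \<longleftrightarrow> a \<le> i \<and> i < b)"

lemma segment_head: "segment a b t \<Longrightarrow> t 0 \<noteq> 0 \<longleftrightarrow> a \<le> 0 \<and> 0 < b"
  by (simp add: segment_def)

lemma segment_Right:
  assumes "segment a b (t(0 := s))"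
  shows "segment (a - 1) (b - 1) (act_tape (s, Move_Right) t)"
  unfolding segment_def act_tape.simps shift_tape.simps
proof
  fix i
  have "(t(0 := s)) (i + 1) \<noteq> 0 \<longleftrightarrow> a \<le> i + 1 \<and> i + 1 < b"
    using assms unfolding segment_def by (rule spec)
  also have "\<dots> \<longleftrightarrow> a - 1 \<le> i \<and> i < b - 1" by linarith
  finally show "(t(0 := s)) (i + 1) \<noteq> 0 \<longleftrightarrow> a - 1 \<le> i \<and> i < b - 1" .
qed

lemma segment_Left:
  assumes "segment a b (t(0 := s))"
  shows "segment (a + 1) (b + 1) (act_tape (s, Move_Left) t)"
  unfolding segment_def act_tape.simps shift_tape.simps
proof
  fix i
  have "(t(0 := s)) (i - 1) \<noteq> 0 \<longleftrightarrow> a \<le> i - 1 \<and> i - 1 < b"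
    using assms unfolding segment_def by (rule spec)
  also have "\<dots> \<longleftrightarrow> a + 1 \<le> i \<and> i < b + 1" by linarith
  finally show "(t(0 := s)) (i - 1) \<noteq> 0 \<longleftrightarrow> a + 1 \<le> i \<and> i < b + 1" .
qed

text \<open>The bounds say that the head is inside the interval or next to it, so filling its cell
  leaves no gap.\<close>

lemma segment_visit:
  assumes "segment a b t" "a \<le> 1" "0 \<le> b"
  shows "segment (min a 0) (max b 1) (t(0 := 1))"
  unfolding segment_def
proof
  fix i
  show "(t(0 := 1)) i \<noteq> 0 \<longleftrightarrow> min a 0 \<le> i \<and> i < max b 1"
  proof (cases "i = 0")
    case False
    have "t i \<noteq> 0 \<longleftrightarrow> a \<le> i \<and> i < b"
      using assms(1) unfolding segment_def by (rule spec)
    also have "\<dots> \<longleftrightarrow> min a 0 \<le> i \<and> i < max b 1"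
      using False assms(2,3) by linarith
    finally show ?thesis using False by simp
  qed simp
qed

lemma segment_erase:
  assumes "segment a 1 t"
  shows "segment a 0 (t(0 := 0))"
  unfolding segment_def
proof
  fix i
  show "(t(0 := 0)) i \<noteq> 0 \<longleftrightarrow> a \<le> i \<and> i < 0"
  proof (cases "i = 0")
    case False
    have "t i \<noteq> 0 \<longleftrightarrow> a \<le> i \<and> i < 1"
      using assms unfolding segment_def by (rule spec)
    also have "\<dots> \<longleftrightarrow> a \<le> i \<and> i < 0"
      using False by linarith
    finally show ?thesis using False by simp
  qed simp
qed

lemma segment_empty:
  assumes "segment a a t"
  shows "t = zipper [] []"
proof
  fix i
  have "t i \<noteq> 0 \<longleftrightarrow> a \<le> i \<and> i < a"
    using assms unfolding segment_def by (rule spec)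
  then show "t i = zipper [] [] i"
    by (auto simp: zipper_def)
qed

text \<open>
  The searcher has two tapes of its own, the input \<open>x\<close> and a copy of it whose head moves from block
  to block, followed by the tapes of \<open>M\<close>. For each inner block \<open>b\<close> it writes \<open>x @ b @ [4]\<close> on the
  first tape of \<open>M\<close> and simulates \<open>M\<close>. The simulation writes the extra symbol \<open>num_symbols M\<close>
  instead of the blank: the visited cells are then exactly the nonzero ones, so the tapes can be
  erased before the next block is tried.

  States below \<open>num_states M\<close> are those of \<open>M\<close>. With \<open>Q = num_states M\<close>, the others are:
  \<open>Q\<close> accept, \<open>Q + 1\<close> reject, \<open>Q + 2\<close> copy the input to the second tape,
  \<open>Q + 3\<close> check that it ends with 4, \<open>Q + 4\<close> rewind both tapes, \<open>Q + 5\<close> skip the first block,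
  \<open>Q + 6\<close> copy the input to the first tape of \<open>M\<close>, \<open>Q + 7\<close> rewind the input,
  \<open>Q + 8\<close> copy the current block, \<open>Q + 9\<close> rewind the first tape of \<open>M\<close>,
  \<open>Q + 10\<close> move to the right ends of the visited segments, \<open>Q + 11\<close> erase them leftwards.
\<close>

locale block_search =
  fixes M :: turing_machine and L :: "nat list set" and p :: "nat poly"
  assumes decides: "decides_in_time M 4 L (poly p)"
begin

abbreviation "Q \<equiv> num_states M"
abbreviation "G \<equiv> num_symbols M"
abbreviation "N \<equiv> num_tapes M"

definition mark :: "nat \<Rightarrow> nat" where
  "mark s = (if s = 0 then G else s)"

definition unmark :: "nat \<Rightarrow> nat" where
  "unmark s = (if s = G then 0 else s)"

abbreviation keep :: "nat list \<Rightarrow> (nat \<times> move) list" where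
  "keep ss \<equiv> map (\<lambda>s. (s, Stay)) ss"

fun search_transition :: "nat \<Rightarrow> nat list \<Rightarrow> nat \<times> (nat \<times> move) list" where
  "search_transition q (i # s # ts) =
     (if q < Q then
        if q = accept_state M then (Q, keep (i # s # ts))
        else if q = reject_state M then
          (Q + 10, (i, Stay) # (s, Stay) # map (\<lambda>t. (mark t, Move_Right)) ts)
        else case transition M q (map unmark ts) of (q', acts) \<Rightarrow>
          (q', (i, Stay) # (s, Stay) # map (\<lambda>(t, m). (mark t, m)) acts)
      else if q = Q + 2 then
        if i = 0 then (Q + 3, (i, Move_Left) # (s, Move_Left) # keep ts)
        else (Q + 2, (i, Move_Right) # (i, Move_Right) # keep ts)
      else if q = Q + 3 then (if i = 4 then Q + 4 else Q + 1, keep (i # s # ts))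
      else if q = Q + 4 then
        if i = 0 then (Q + 5, (i, Move_Right) # (s, Move_Right) # keep ts)
        else (Q + 4, (i, Move_Left) # (s, Move_Left) # keep ts)
      else if q = Q + 5 then
        (if s = 4 then Q + 6 else Q + 5, (i, Stay) # (s, Move_Right) # keep ts)
      else if q = Q + 6 then
        if i = 0 then (Q + 7, (i, Move_Left) # (s, Stay) # keep ts)
        else (Q + 6, (i, Move_Right) # (s, Stay) # (i, Move_Right) # keep (tl ts))
      else if q = Q + 7 then
        if i = 0 then (Q + 8, (i, Move_Right) # (s, Stay) # keep ts)
        else (Q + 7, (i, Move_Left) # (s, Stay) # keep ts)
      else if q = Q + 8 then
        if s = 0 then (Q + 1, keep (i # s # ts))
        else if s = 4 then (Q + 9, (i, Stay) # (s, Move_Right) # (s, Stay) # keep (tl ts))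
        else (Q + 8, (i, Stay) # (s, Move_Right) # (s, Move_Right) # keep (tl ts))
      else if q = Q + 9 then
        if hd ts = 0 then (start_state M, (i, Stay) # (s, Stay) # (0, Move_Right) # keep (tl ts))
        else (Q + 9, (i, Stay) # (s, Stay) # (hd ts, Move_Left) # keep (tl ts))
      else if q = Q + 10 then
        if \<forall>t \<in> set ts. t = 0 then
          (Q + 11, (i, Stay) # (s, Stay) # map (\<lambda>t. (t, Move_Left)) ts)
        else
          (Q + 10, (i, Stay) # (s, Stay) # map (\<lambda>t. (t, if t = 0 then Stay else Move_Right)) ts)
      else
        if \<forall>t \<in> set ts. t = 0 then (Q + 6, keep (i # s # ts))
        else (Q + 11, (i, Stay) # (s, Stay) # map (\<lambda>t. (0, if t = 0 then Stay else Move_Left)) ts))"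
| "search_transition q ss = (Q + 1, keep ss)"

definition searcher :: turing_machine where
  "searcher = \<lparr>num_tapes = N + 2, num_states = Q + 12, num_symbols = G + 1,
     start_state = Q + 2, accept_state = Q, reject_state = Q + 1,
     transition = search_transition\<rparr>"

lemma searcher_simps [simp]:
  "num_tapes searcher = N + 2" "num_states searcher = Q + 12" "num_symbols searcher = G + 1"
  "start_state searcher = Q + 2" "accept_state searcher = Q" "reject_state searcher = Q + 1"
  "transition searcher = search_transition"
  by (simp_all add: searcher_def)

lemma wf_M: "wf_turing_machine M"
  and four_less_G: "4 < G"
  using decides by (auto simp: decides_in_time_def)

lemma tapes_M: "1 \<le> N" and states_M: "start_state M < Q" "accept_state M < Q" "reject_state M < Q"
  "accept_state M \<noteq> reject_state M"
  using wf_M by (auto simp: wf_turing_machine_def)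

lemma mark_neq_0: "mark s \<noteq> 0"
  using four_less_G by (simp add: mark_def)

lemma unmark_mark: "s < G \<Longrightarrow> unmark (mark s) = s"
  using four_less_G by (simp add: mark_def unmark_def)

lemma wf_searcher: "wf_turing_machine searcher"
proof -
  have "case search_transition q ss of (q', acts) \<Rightarrow>
      q' < Q + 12 \<and> length acts = N + 2 \<and> (\<forall>(s, m) \<in> set acts. s < G + 1)"
    if q: "q < Q + 12" and len: "length ss = N + 2" and ss: "set ss \<subseteq> {..<G + 1}" for q ss
  proof -
    obtain i s t ts where eq: "ss = i # s # t # ts"
      using len tapes_M by (cases ss; cases "tl ss"; cases "tl (tl ss)") auto
    have mark_le: "mark a \<le> G" if "a \<le> G" for a
      using that by (simp add: mark_def)
    show ?thesis
    proof (cases "q < Q \<and> q \<noteq> accept_state M \<and> q \<noteq> reject_state M")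
      case True
      obtain q' acts where tr: "transition M q (map unmark (t # ts)) = (q', acts)"
        by (cases "transition M q (map unmark (t # ts))")
      have "set (map unmark (t # ts)) \<subseteq> {..<G}"
        using ss eq four_less_G by (auto simp: unmark_def)
      from wf_transition[OF wf_M _ _ this tr] True len eq
      have "q' < Q" "length acts = N" "\<And>s m. (s, m) \<in> set acts \<Longrightarrow> s < G"
        by auto
      then show ?thesis
        using True tr ss len eq four_less_G by (fastforce simp: mark_def)
    next
      case False
      have "\<And>a. a \<in> set ts \<Longrightarrow> a \<le> G" "i \<le> G" "s \<le> G" "t \<le> G"
        using ss eq by auto
      then show ?thesis
        using False len states_M mark_le unfolding eq by (auto simp: less_Suc_eq_le)
    qed
  qed
  then show ?thesis
    unfolding wf_turing_machine_def by (simp del: search_transition.simps)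
qed

section \<open>Copying and rewinding phases of the searcher\<close>

lemma copy_input:
  assumes "0 \<notin> set r"
  shows "reaches searcher (length r) (Q + 2, zipper l r # zipper l [] # ts)
    (Q + 2, zipper (rev r @ l) [] # zipper (rev r @ l) [] # ts)"
  using assms
proof (induction r arbitrary: l)
  case (Cons a r)
  have "tm_step searcher (Q + 2, zipper l (a # r) # zipper l [] # ts) =
      (Q + 2, zipper (a # l) r # zipper (a # l) [] # ts)"
    using Cons.prems by (simp add: o_def)
  from reaches_Suc[OF this] Cons show ?case by simp
qed (simp add: reaches_refl)

text \<open>The two extra steps go onto the blank left of the contents and back; no symbol of the
  contents is mistaken for that blank.\<close>

lemma rewind_copies:
  assumes "0 \<notin> set l" "a \<noteq> 0"
  shows "reaches searcher (length l + 2) (Q + 4, zipper l (a # r) # zipper l (a # r) # ts)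
    (Q + 5, zipper [] (rev l @ a # r) # zipper [] (rev l @ a # r) # ts)"
  using assms
proof (induction l arbitrary: a r)
  case Nil
  have "tm_step searcher (Q + 4, zipper [] (a # r) # zipper [] (a # r) # ts) =
      (Q + 4, zipper [] (0 # a # r) # zipper [] (0 # a # r) # ts)"
    "tm_step searcher (Q + 4, zipper [] (0 # a # r) # zipper [] (0 # a # r) # ts) =
      (Q + 5, zipper [] (a # r) # zipper [] (a # r) # ts)"
    using Nil by (simp_all add: o_def)
  from reaches_Suc[OF this(1) reaches_Suc[OF this(2) reaches_refl]] show ?case
    by (simp add: numeral_2_eq_2)
next
  case (Cons c l)
  have "tm_step searcher (Q + 4, zipper (c # l) (a # r) # zipper (c # l) (a # r) # ts) =
      (Q + 4, zipper l (c # a # r) # zipper l (c # a # r) # ts)"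
    using Cons.prems by (simp add: o_def)
  from reaches_Suc[OF this Cons.IH] Cons.prems show ?case by simp
qed

lemma skip_block:
  assumes "4 \<notin> set c"
  shows "reaches searcher (length c + 1) (Q + 5, ti # zipper l (c @ 4 # r) # ts)
    (Q + 6, ti # zipper (4 # rev c @ l) r # ts)"
  using assms
proof (induction c arbitrary: l)
  case Nil
  have "tm_step searcher (Q + 5, ti # zipper l (4 # r) # ts) = (Q + 6, ti # zipper (4 # l) r # ts)"
    by (simp add: o_def)
  from reaches_Suc[OF this reaches_refl] show ?case by simp
next
  case (Cons a c)
  have "tm_step searcher (Q + 5, ti # zipper l (a # c @ 4 # r) # ts) =
      (Q + 5, ti # zipper (a # l) (c @ 4 # r) # ts)"
    using Cons.prems by (simp add: o_def)
  from reaches_Suc[OF this Cons.IH] Cons.prems show ?case by simp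
qed

lemma copy_input_to_M:
  assumes "0 \<notin> set r"
  shows "reaches searcher (length r) (Q + 6, zipper l r # tb # zipper m [] # ts)
    (Q + 6, zipper (rev r @ l) [] # tb # zipper (rev r @ m) [] # ts)"
  using assms
proof (induction r arbitrary: l m)
  case (Cons a r)
  have "tm_step searcher (Q + 6, zipper l (a # r) # tb # zipper m [] # ts) =
      (Q + 6, zipper (a # l) r # tb # zipper (a # m) [] # ts)"
    using Cons.prems by (simp add: o_def)
  from reaches_Suc[OF this] Cons show ?case by simp
qed (simp add: reaches_refl)

lemma rewind_input:
  assumes "0 \<notin> set l" "a \<noteq> 0"
  shows "reaches searcher (length l + 2) (Q + 7, zipper l (a # r) # tb # ts)
    (Q + 8, zipper [] (rev l @ a # r) # tb # ts)"
  using assms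
proof (induction l arbitrary: a r)
  case Nil
  have "tm_step searcher (Q + 7, zipper [] (a # r) # tb # ts) = (Q + 7, zipper [] (0 # a # r) # tb # ts)"
    "tm_step searcher (Q + 7, zipper [] (0 # a # r) # tb # ts) = (Q + 8, zipper [] (a # r) # tb # ts)"
    using Nil by (simp_all add: o_def)
  from reaches_Suc[OF this(1) reaches_Suc[OF this(2) reaches_refl]] show ?case
    by (simp add: numeral_2_eq_2)
next
  case (Cons c l)
  have "tm_step searcher (Q + 7, zipper (c # l) (a # r) # tb # ts) =
      (Q + 7, zipper l (c # a # r) # tb # ts)"
    using Cons.prems by (simp add: o_def)
  from reaches_Suc[OF this Cons.IH] Cons.prems show ?case by simp
qed

lemma copy_block:
  assumes "0 \<notin> set b" "4 \<notin> set b"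
  shows "reaches searcher (length b + 1) (Q + 8, ti # zipper l (b @ 4 # r) # zipper m [] # ts)
    (Q + 9, ti # zipper (4 # rev b @ l) r # zipper (rev b @ m) [4] # ts)"
  using assms
proof (induction b arbitrary: l m)
  case Nil
  have "tm_step searcher (Q + 8, ti # zipper l (4 # r) # zipper m [] # ts) =
      (Q + 9, ti # zipper (4 # l) r # zipper m [4] # ts)"
    by (simp add: o_def)
  from reaches_Suc[OF this reaches_refl] show ?case by simp
next
  case (Cons a b)
  have "tm_step searcher (Q + 8, ti # zipper l (a # b @ 4 # r) # zipper m [] # ts) =
      (Q + 8, ti # zipper (a # l) (b @ 4 # r) # zipper (a # m) [] # ts)"
    using Cons.prems by (simp add: o_def)
  from reaches_Suc[OF this Cons.IH] Cons.prems show ?case by simp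
qed

text \<open>A string after the last 4 is no block: the copy runs into the blank, and by then all
  blocks have been tried.\<close>

lemma copy_block_fails:
  assumes "0 \<notin> set b" "4 \<notin> set b"
  shows "\<exists>ts'. reaches searcher (length b + 1) (Q + 8, ti # zipper l b # zipper m [] # ts) (Q + 1, ts')"
  using assms
proof (induction b arbitrary: l m)
  case Nil
  have "tm_step searcher (Q + 8, ti # zipper l [] # zipper m [] # ts) =
      (Q + 1, ti # zipper l [] # zipper m [] # ts)"
    by (simp add: o_def del: zipper_Stay)
  from reaches_Suc[OF this reaches_refl] show ?case by auto
next
  case (Cons a b)
  have "tm_step searcher (Q + 8, ti # zipper l (a # b) # zipper m [] # ts) =
      (Q + 8, ti # zipper (a # l) b # zipper (a # m) [] # ts)"
    using Cons.prems by (simp add: o_def)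
  from reaches_Suc[OF this] Cons show ?case by fastforce
qed

text \<open>The left end is recognised by a genuine blank 0, which is why the tapes must be wiped,
  not merely marked, before a new block is written.\<close>

lemma rewind_M:
  assumes "0 \<notin> set l" "a \<noteq> 0"
  shows "reaches searcher (length l + 2) (Q + 9, ti # tb # zipper l (a # r) # ts)
    (start_state M, ti # tb # zipper [] (rev l @ a # r) # ts)"
  using assms
proof (induction l arbitrary: a r)
  case Nil
  have "tm_step searcher (Q + 9, ti # tb # zipper [] (a # r) # ts) =
      (Q + 9, ti # tb # zipper [] (0 # a # r) # ts)"
    "tm_step searcher (Q + 9, ti # tb # zipper [] (0 # a # r) # ts) =
      (start_state M, ti # tb # zipper [] (a # r) # ts)"
    using Nil by (simp_all add: o_def)
  from reaches_Suc[OF this(1) reaches_Suc[OF this(2) reaches_refl]] show ?case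
    by (simp add: numeral_2_eq_2)
next
  case (Cons c l)
  have "tm_step searcher (Q + 9, ti # tb # zipper (c # l) (a # r) # ts) =
      (Q + 9, ti # tb # zipper l (c # a # r) # ts)"
    using Cons.prems by (simp add: o_def)
  from reaches_Suc[OF this Cons.IH] Cons.prems show ?case by simp
qed

section \<open>Simulation of \<open>M\<close> with marked blanks\<close>

text \<open>The cell under the head need not have been visited yet, hence the update at 0.\<close>

definition sim_tape :: "nat \<Rightarrow> tape \<Rightarrow> bool" where
  "sim_tape D t \<longleftrightarrow> (\<forall>i. t i \<le> G) \<and>
     (\<exists>a b. - int D \<le> a \<and> a \<le> 0 \<and> 0 < b \<and> b \<le> int D + 1 \<and> segment a b (t(0 := 1)))"

lemma segment_upd_nonzero:
  assumes "segment a b (t(0 := 1))" "s \<noteq> 0"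
  shows "segment a b (t(0 := s))"
proof -
  have "((t(0 := s)) i \<noteq> 0) = ((t(0 := 1)) i \<noteq> 0)" for i
    using assms(2) by simp
  then show ?thesis
    using assms(1) unfolding segment_def by (simp only: simp_thms)
qed

text \<open>\<open>mark s\<close> is never 0, so the cell left behind belongs to the visited
  interval and the head ends at most one cell beyond it. Taking \<open>min\<close> with 0 and
  \<open>max\<close> with 1 includes the new head cell.\<close>

lemma sim_tape_act:
  assumes "s < G" "sim_tape D t"
  shows "sim_tape (Suc D) (act_tape (mark s, m) t)"
proof -
  obtain a b where le: "\<forall>i. t i \<le> G" and ab: "- int D \<le> a" "a \<le> 0" "0 < b" "b \<le> int D + 1"
    and "segment a b (t(0 := 1))"
    using assms(2) by (auto simp: sim_tape_def)
  then have seg: "segment a b (t(0 := mark s))"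
    using segment_upd_nonzero mark_neq_0 by blast
  have cells: "\<forall>i. act_tape (mark s, m) t i \<le> G"
    using act_tape_cell_less[of t "Suc G" "mark s" m] le assms(1)
    by (auto simp: less_Suc_eq_le mark_def)
  have "\<exists>a' b'. - int (Suc D) \<le> a' \<and> a' \<le> 0 \<and> 0 < b' \<and> b' \<le> int (Suc D) + 1 \<and>
    segment a' b' ((act_tape (mark s, m) t)(0 := 1))"
  proof -
    obtain a' b' where "segment a' b' (act_tape (mark s, m) t)" "a - 1 \<le> a'" "a' \<le> a + 1"
      "b - 1 \<le> b'" "b' \<le> b + 1"
    proof (cases m)
      case Stay
      show ?thesis using that[of a b] seg unfolding Stay act_tape.simps by simp
    next
      case Move_Right
      show ?thesis using that[of "a - 1" "b - 1"] segment_Right[OF seg] unfolding Move_Right by simp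
    next
      case Move_Left
      show ?thesis using that[of "a + 1" "b + 1"] segment_Left[OF seg] unfolding Move_Left by simp
    qed
    with ab segment_visit[of a' b'] show ?thesis
      by (intro exI[of _ "min a' 0"] exI[of _ "max b' 1"]) auto
  qed
  with cells show ?thesis unfolding sim_tape_def by blast
qed

lemma unmark_act:
  assumes "s < G"
  shows "unmark \<circ> act_tape (mark s, m) t = act_tape (s, m) (unmark \<circ> t)"
  using unmark_mark[OF assms] by (cases m) (auto simp: act_tape.simps)

lemma sim_step:
  assumes q: "q < Q" "q \<noteq> accept_state M" "q \<noteq> reject_state M"
    and ts: "length ts = N" "\<forall>t \<in> set ts. sim_tape D t"
  obtains q' ts' where "q' < Q" "length ts' = N" "\<forall>t \<in> set ts'. sim_tape (Suc D) t"
    and "tm_step M (q, map (\<lambda>t. unmark \<circ> t) ts) = (q', map (\<lambda>t. unmark \<circ> t) ts')"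
    and "tm_step searcher (q, ti # tb # ts) = (q', ti # tb # ts')"
proof -
  obtain q' acts where tr: "transition M q (map (\<lambda>t. unmark (t 0)) ts) = (q', acts)"
    by (cases "transition M q (map (\<lambda>t. unmark (t 0)) ts)")
  have "set (map (\<lambda>t. unmark (t 0)) ts) \<subseteq> {..<G}"
  proof -
    have "unmark (t 0) < G" if "t \<in> set ts" for t
    proof -
      have "t 0 \<le> G" using ts(2) that by (simp add: sim_tape_def)
      then show ?thesis using four_less_G by (auto simp: unmark_def)
    qed
    then show ?thesis by auto
  qed
  from wf_transition[OF wf_M q(1) _ this tr] ts(1)
  have q': "q' < Q" and acts: "length acts = N" "\<And>s m. (s, m) \<in> set acts \<Longrightarrow> s < G"
    by auto
  let ?ts = "map2 (\<lambda>(s, m). act_tape (mark s, m)) acts ts"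
  have nth: "?ts ! j = act_tape (mark (fst (acts ! j)), snd (acts ! j)) (ts ! j)"
    "fst (acts ! j) < G" if "j < N" for j
    using acts ts(1) that by (auto simp: case_prod_beta intro!: acts(2)[of _ "snd (acts ! j)"])
  have "\<forall>t \<in> set ?ts. sim_tape (Suc D) t"
  proof
    fix u assume "u \<in> set ?ts"
    then obtain j where "j < length ?ts" "u = ?ts ! j"
      unfolding in_set_conv_nth by blast
    moreover from this have "j < N"
      using acts(1) by simp
    ultimately have "j < N" "u = ?ts ! j"
      by blast+
    with nth[of j] ts show "sim_tape (Suc D) u"
      by (simp add: sim_tape_act)
  qed
  moreover have "map2 act_tape acts (map (\<lambda>t. unmark \<circ> t) ts) = map (\<lambda>t. unmark \<circ> t) ?ts"
    using nth acts(1) ts(1)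
    by (intro nth_equalityI) (auto simp: unmark_act case_prod_beta)
  moreover have "map2 act_tape (map (\<lambda>(t, m). (mark t, m)) acts) ts = ?ts"
    using acts(1) ts(1) by (intro nth_equalityI) (auto simp: case_prod_beta)
  ultimately show ?thesis
    using that[of q' ?ts] q q' tr acts(1) ts(1) by (simp add: o_def)
qed

lemma sim_run:
  assumes "q < Q" "length ts = N" "\<forall>t \<in> set ts. sim_tape D t"
    and "fst ((tm_step M ^^ n) (q, map (\<lambda>t. unmark \<circ> t) ts)) = h"
    and "h = accept_state M \<or> h = reject_state M"
  shows "\<exists>ts'. reaches searcher n (q, ti # tb # ts) (h, ti # tb # ts') \<and> length ts' = N \<and>
    (\<forall>t \<in> set ts'. sim_tape (D + n) t)"
  using assms
proof (induction n arbitrary: q ts D)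
  case 0
  then show ?case by (auto intro: reaches_refl)
next
  case (Suc n)
  show ?case
  proof (cases "q = accept_state M \<or> q = reject_state M")
    case True
    \<comment> \<open>The searcher does not halt in the halting states of \<open>M\<close>, so its
      run has to stop here with zero steps.\<close>
    then have "q = h" using Suc.prems(4) by (simp only: funpow_tm_step_halted[OF True]) simp
    moreover have "sim_tape (D + Suc n) t" if "t \<in> set ts" for t
      using Suc.prems(3) that unfolding sim_tape_def by (smt (verit) of_nat_add of_nat_0_le_iff)
    ultimately show ?thesis
      using Suc.prems(2) by (auto intro: reaches_refl)
  next
    case False
    then obtain q' ts' where s: "q' < Q" "length ts' = N" "\<forall>t \<in> set ts'. sim_tape (Suc D) t"
      "tm_step M (q, map (\<lambda>t. unmark \<circ> t) ts) = (q', map (\<lambda>t. unmark \<circ> t) ts')"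
      "tm_step searcher (q, ti # tb # ts) = (q', ti # tb # ts')"
      using sim_step[OF Suc.prems(1) _ _ Suc.prems(2,3)] by blast
    have funpow_Suc: "(tm_step M ^^ Suc n) c = (tm_step M ^^ n) (tm_step M c)" for c
      by (simp only: funpow_Suc_right comp_apply)
    have "fst ((tm_step M ^^ n) (q', map (\<lambda>t. unmark \<circ> t) ts')) = h"
      using Suc.prems(4) funpow_Suc[of "(q, map (\<lambda>t. unmark \<circ> t) ts)"] s(4) by (simp only:)
    from Suc.IH[OF s(1,2,3) this Suc.prems(5)] reaches_Suc[OF s(5)] show ?thesis
      by auto
  qed
qed

section \<open>Erasing the tapes of \<open>M\<close>\<close>

text \<open>\<open>n\<close> bounds the steps to the right end and \<open>D\<close> the length of
  the interval, which moving preserves. As \<open>a < 0\<close>, a 0 under the head can only mean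
  \<open>b = 0\<close>, the first cell right of the interval.\<close>

definition rightwards :: "nat \<Rightarrow> nat \<Rightarrow> tape \<Rightarrow> bool" where
  "rightwards D n t \<longleftrightarrow> (\<exists>a b. a < 0 \<and> 0 \<le> b \<and> b \<le> int n \<and> b - a \<le> int D \<and> segment a b t)"

text \<open>The head is on the last visited cell, and \<open>1 - a\<close> cells remain to be
  erased; \<open>a = 1\<close> is the blank tape.\<close>

definition leftwards :: "nat \<Rightarrow> tape \<Rightarrow> bool" where
  "leftwards n t \<longleftrightarrow> (\<exists>a. a \<le> 1 \<and> 1 - a \<le> int n \<and> segment a 1 t)"

lemma finish_rightwards:
  assumes "\<forall>t \<in> set ts. rightwards D n t" "\<forall>t \<in> set ts. t 0 = 0"
  shows "\<exists>ts'. reaches searcher (Suc 0) (Q + 10, ti # tb # ts) (Q + 11, ti # tb # ts') \<and>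
    length ts' = length ts \<and> (\<forall>t \<in> set ts'. leftwards D t)"
proof -
  let ?f = "\<lambda>t. act_tape (t 0, Move_Left) t"
  have step: "tm_step searcher (Q + 10, ti # tb # ts) = (Q + 11, ti # tb # map ?f ts)"
    using assms(2) by (simp add: o_def)
  have "leftwards D (?f t)" if "t \<in> set ts" for t
  proof -
    obtain a b where ab: "a < 0" "0 \<le> b" "b - a \<le> int D" "segment a b t"
      using assms(1) \<open>t \<in> set ts\<close> by (auto simp: rightwards_def)
    have "b = 0"
      using assms(2) that segment_head[OF ab(4)] ab by auto
    then have "segment (a + 1) 1 (?f t)"
      using segment_Left[of a b t "t 0"] ab by simp
    then show ?thesis
      using ab \<open>b = 0\<close> unfolding leftwards_def by (intro exI[of _ "a + 1"]) auto
  qed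
  then show ?thesis
    using reaches_Suc[OF step reaches_refl] by (intro exI[of _ "map ?f ts"]) auto
qed

lemma finish_leftwards:
  assumes "\<forall>t \<in> set ts. leftwards n t" "\<forall>t \<in> set ts. t 0 = 0"
  shows "reaches searcher (Suc 0) (Q + 11, ti # tb # ts)
    (Q + 6, ti # tb # replicate (length ts) (zipper [] []))"
proof -
  have "t = zipper [] []" if t: "t \<in> set ts" for t
  proof -
    obtain a where a: "a \<le> 1" "segment a 1 t"
      using assms(1) t by (auto simp: leftwards_def)
    then have "a = 1" using assms(2) t segment_head[OF a(2)] by auto
    then show ?thesis using a segment_empty by blast
  qed
  then have "ts = replicate (length ts) (zipper [] [])"
    by (simp add: replicate_eqI)
  moreover have "tm_step searcher (Q + 11, ti # tb # ts) = (Q + 6, ti # tb # ts)"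
    using assms(2) by (simp add: o_def cong: map_cong)
  ultimately show ?thesis
    using reaches_Suc[OF _ reaches_refl] by metis
qed

text \<open>The heads move in parallel, and one that has passed its interval waits on the 0 for the
  others. Its own distance is then 0, so the common bound \<open>n\<close> still decreases.\<close>

lemma move_rightwards:
  assumes "\<forall>t \<in> set ts. rightwards D n t"
  shows "\<exists>ts'. reaches searcher (Suc n) (Q + 10, ti # tb # ts) (Q + 11, ti # tb # ts') \<and>
    length ts' = length ts \<and> (\<forall>t \<in> set ts'. leftwards D t)"
  using assms
proof (induction n arbitrary: ts)
  case (Suc n)
  show ?case
  proof (cases "\<forall>t \<in> set ts. t 0 = 0")
    case True
    with finish_rightwards Suc.prems obtain ts' where
      "reaches searcher (Suc 0) (Q + 10, ti # tb # ts) (Q + 11, ti # tb # ts')"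
      "length ts' = length ts" "\<forall>t \<in> set ts'. leftwards D t"
      by blast
    then show ?thesis by (meson Suc_le_mono le0 reaches_mono)
  next
    case False
    let ?f = "\<lambda>t. act_tape (t 0, if t 0 = 0 then Stay else Move_Right) t"
    have step: "tm_step searcher (Q + 10, ti # tb # ts) = (Q + 10, ti # tb # map ?f ts)"
      using False by (simp add: o_def del: act_tape_Stay) simp
    have "rightwards D n (?f t)" if t: "t \<in> set ts" for t
    proof -
      obtain a b where ab: "a < 0" "0 \<le> b" "b \<le> int (Suc n)" "b - a \<le> int D" "segment a b t"
        using Suc.prems t unfolding rightwards_def by blast
      show ?thesis
      proof (cases "t 0 = 0")
        case True
        then have "b = 0" using segment_head[OF ab(5)] ab by simp
        then show ?thesis
          using True ab unfolding rightwards_def by (intro exI[of _ a] exI[of _ 0]) auto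
      next
        case False
        then have "0 < b" using segment_head[OF ab(5)] by simp
        moreover have "segment (a - 1) (b - 1) (?f t)"
          using segment_Right[of a b t "t 0"] ab(5) False by simp
        ultimately show ?thesis
          using ab unfolding rightwards_def by (intro exI[of _ "a - 1"] exI[of _ "b - 1"]) auto
      qed
    qed
    then have "\<forall>t \<in> set (map ?f ts). rightwards D n t" by simp
    from Suc.IH[OF this] obtain ts' where
      "reaches searcher (Suc n) (Q + 10, ti # tb # map ?f ts) (Q + 11, ti # tb # ts')"
      "length ts' = length ts" "\<forall>t \<in> set ts'. leftwards D t"
      unfolding length_map by blast
    with reaches_Suc[OF step] show ?thesis by blast
  qed
next
  case 0
  have "t 0 = 0" if "t \<in> set ts" for t
    using 0 that segment_head by (fastforce simp: rightwards_def)
  with 0 show ?case by (simp add: finish_rightwards)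
qed

text \<open>Erased from the right, the remaining cells stay an interval, so a 0 under the head means
  that this tape is empty.\<close>

lemma erase_leftwards:
  assumes "\<forall>t \<in> set ts. leftwards n t"
  shows "reaches searcher (Suc n) (Q + 11, ti # tb # ts)
    (Q + 6, ti # tb # replicate (length ts) (zipper [] []))"
  using assms
proof (induction n arbitrary: ts)
  case (Suc n)
  show ?case
  proof (cases "\<forall>t \<in> set ts. t 0 = 0")
    case True
    with finish_leftwards Suc.prems show ?thesis by (meson Suc_le_mono le0 reaches_mono)
  next
    case False
    let ?f = "\<lambda>t. act_tape (0, if t 0 = 0 then Stay else Move_Left) t"
    have step: "tm_step searcher (Q + 11, ti # tb # ts) = (Q + 11, ti # tb # map ?f ts)"
      using False by (simp add: o_def del: act_tape_Stay) simp
    have "leftwards n (?f t)" if t: "t \<in> set ts" for t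
    proof -
      obtain a where a: "a \<le> 1" "1 - a \<le> int (Suc n)" "segment a 1 t"
        using Suc.prems t unfolding leftwards_def by blast
      show ?thesis
      proof (cases "t 0 = 0")
        case True
        then have "a = 1" using segment_head[OF a(3)] a by simp
        then show ?thesis using True a unfolding leftwards_def by auto
      next
        case False
        then have "a \<le> 0" using segment_head[OF a(3)] by simp
        moreover have "segment a 0 (t(0 := 0))"
          using a(3) by (rule segment_erase)
        then have "segment (a + 1) 1 (?f t)"
          using segment_Left[of a 0 t 0] False by simp
        ultimately show ?thesis
          using a unfolding leftwards_def by (intro exI[of _ "a + 1"]) auto
      qed
    qed
    then have "\<forall>t \<in> set (map ?f ts). leftwards n t" by simp
    from reaches_Suc[OF step Suc.IH[OF this]] show ?thesis by simp
  qed
next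
  case 0
  have "t 0 = 0" if "t \<in> set ts" for t
    using 0 that segment_head by (fastforce simp: leftwards_def)
  with 0 show ?case by (simp add: finish_leftwards)
qed

text \<open>The rejecting step marks the head cell, which may be unvisited, and moves right, past
  the left end of the interval. At most \<open>2 * D + 1\<close> cells are visited, so the bound is
  \<open>1 + (D + 1) + (2 * D + 2)\<close>.\<close>

lemma clean:
  assumes "\<forall>t \<in> set ts. sim_tape D t" "length ts = N"
  shows "reaches searcher (3 * D + 4) (reject_state M, ti # tb # ts)
    (Q + 6, ti # tb # replicate N (zipper [] []))"
proof -
  let ?f = "\<lambda>t. act_tape (mark (t 0), Move_Right) t"
  have step: "tm_step searcher (reject_state M, ti # tb # ts) = (Q + 10, ti # tb # map ?f ts)"
    using states_M by (simp add: o_def)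
  have "rightwards (2 * D + 1) D (?f t)" if t: "t \<in> set ts" for t
  proof -
    obtain a b where ab: "- int D \<le> a" "a \<le> 0" "0 < b" "b \<le> int D + 1" "segment a b (t(0 := 1))"
      using assms(1) t by (auto simp: sim_tape_def)
    have "segment (a - 1) (b - 1) (?f t)"
      using segment_Right segment_upd_nonzero[OF ab(5) mark_neq_0] by blast
    then show ?thesis
      using ab unfolding rightwards_def by (intro exI[of _ "a - 1"] exI[of _ "b - 1"]) auto
  qed
  then have "\<forall>t \<in> set (map ?f ts). rightwards (2 * D + 1) D t" by simp
  from move_rightwards[OF this] obtain ts' where
    ts': "reaches searcher (Suc D) (Q + 10, ti # tb # map ?f ts) (Q + 11, ti # tb # ts')"
    "length ts' = N" "\<forall>t \<in> set ts'. leftwards (2 * D + 1) t"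
    unfolding length_map assms(2) by blast
  from reaches_trans[OF reaches_Suc[OF step ts'(1)] erase_leftwards[OF ts'(3)]] show ?thesis
    using ts'(2) by (auto elim: reaches_mono)
qed

section \<open>The loop over the inner blocks\<close>

text \<open>\<open>rest\<close> lies right of the second head, and the 4 put before it is the
  terminator just passed. Every simulation consumes a 4 of \<open>rest\<close>, so
  \<open>length rest + 1\<close> rounds suffice, the last one failing. The constants are generous: a
  rejecting round takes at most \<open>11 * length x + 8 + 4 * poly p (2 * length x)\<close>
  steps.\<close>

lemma search_loop:
  assumes x: "x \<in> lists {1..4}" "x \<noteq> []"
    and rest: "rest \<in> lists {1..4}" "length rest \<le> length x"
  shows "\<exists>ts'. reaches searcher
    ((length rest + 1) * (20 * length x + 20 + 5 * poly p (2 * length x)))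
    (Q + 6, zipper [] x # zipper ls rest # replicate N (zipper [] []))
    (if \<exists>b \<in> inner_blocks (4 # rest). x @ b @ [4] \<in> L then Q else Q + 1, ts')"
  using rest
proof (induction "length rest" arbitrary: rest ls rule: less_induct)
  case less
  let ?n = "length x"
  let ?K = "20 * ?n + 20 + 5 * poly p (2 * ?n)"
  obtain N' where N: "N = Suc N'" using tapes_M by (cases N) auto
  let ?W = "replicate N' (zipper [] [])"
  have x0: "0 \<notin> set x" using x(1) by auto
  obtain l a where la: "rev x = a # l" using x(2) by (cases "rev x") auto
  then have x_eq: "x = rev l @ [a]" by simp
  with x0 have a: "a \<noteq> 0" "0 \<notin> set l" and len_l: "?n = length l + 1" by auto
  have "reaches searcher ?n (Q + 6, zipper [] x # zipper ls rest # zipper [] [] # ?W)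
    (Q + 6, zipper (rev x) [] # zipper ls rest # zipper (rev x) [] # ?W)"
    using copy_input_to_M[OF x0, of "[]" _ "[]"] by simp
  moreover have "tm_step searcher (Q + 6, zipper (rev x) [] # zipper ls rest # zipper (rev x) [] # ?W)
    = (Q + 7, zipper l [a] # zipper ls rest # zipper (rev x) [] # ?W)"
    unfolding la by (simp add: o_def del: zipper_Stay)
  from reaches_Suc[OF this rewind_input[OF a(2,1)]]
  have "reaches searcher (?n + 2) (Q + 6, zipper (rev x) [] # zipper ls rest # zipper (rev x) [] # ?W)
    (Q + 8, zipper [] x # zipper ls rest # zipper (rev x) [] # ?W)"
    using len_l x_eq by simp
  ultimately have start: "reaches searcher (2 * ?n + 2)
      (Q + 6, zipper [] x # zipper ls rest # replicate N (zipper [] []))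
      (Q + 8, zipper [] x # zipper ls rest # zipper (rev x) [] # ?W)"
    using reaches_trans N by (fastforce simp: mult_2)
  show ?case
  proof (cases "4 \<in> set rest")
    case False
    have "0 \<notin> set rest" using less.prems by auto
    from copy_block_fails[OF this False] obtain ts' where
      "reaches searcher (length rest + 1) (Q + 8, zipper [] x # zipper ls rest # zipper (rev x) [] # ?W)
        (Q + 1, ts')"
      by blast
    from reaches_trans[OF start this]
    have "reaches searcher ((length rest + 1) * ?K)
      (Q + 6, zipper [] x # zipper ls rest # replicate N (zipper [] [])) (Q + 1, ts')"
      by (rule reaches_mono) (use less.prems(2) in simp)
    then show ?thesis using inner_blocks_none[OF False] by auto
  next
    case True
    then obtain b r where br: "rest = b @ 4 # r" "4 \<notin> set b"
      using split_list_first by metis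
    let ?y = "x @ b @ [4]"
    have b0: "0 \<notin> set b" and r: "r \<in> lists {1..4}" and y: "?y \<in> lists {1..4}"
      using less.prems br x(1) by auto
    \<comment> \<open>The block and its terminator lie in \<open>rest\<close>, so the input at most
      doubles; hence \<open>p\<close> is evaluated at \<open>2 * length x\<close>.\<close>
    have len_y: "length ?y \<le> 2 * ?n" using less.prems(2) br by simp
    have len_b: "length b + 1 \<le> ?n" using less.prems(2) br by simp
    let ?S = "zipper (4 # rev b @ ls) r"
    have "reaches searcher (length b + 1) (Q + 8, zipper [] x # zipper ls rest # zipper (rev x) [] # ?W)
      (Q + 9, zipper [] x # ?S # zipper (rev b @ rev x) [4] # ?W)"
      using copy_block[OF b0 br(2)] br by simp
    from reaches_trans[OF start this]
    have copied: "reaches searcher (3 * ?n + 2)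
      (Q + 6, zipper [] x # zipper ls rest # replicate N (zipper [] []))
      (Q + 9, zipper [] x # ?S # zipper (rev b @ rev x) [4] # ?W)"
      by (rule reaches_mono) (use len_b in simp)
    have "reaches searcher (length (rev b @ rev x) + 2)
      (Q + 9, zipper [] x # ?S # zipper (rev b @ rev x) [4] # ?W)
      (start_state M, zipper [] x # ?S # zipper [] ?y # ?W)"
      using rewind_M[of "rev b @ rev x" 4 _ _ "[]" ?W] b0 x0 by simp
    from reaches_trans[OF copied this]
    have written: "reaches searcher (5 * ?n + 4)
      (Q + 6, zipper [] x # zipper ls rest # replicate N (zipper [] []))
      (start_state M, zipper [] x # ?S # zipper [] ?y # ?W)"
      by (rule reaches_mono) (use len_b in simp)
    obtain t where t: "t \<le> poly p (length ?y)"
      "fst ((tm_step M ^^ t) (tm_init M ?y)) = (if ?y \<in> L then accept_state M else reject_state M)"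
      using decides_in_timeD[OF decides y] by blast
    let ?h = "if ?y \<in> L then accept_state M else reject_state M"
    have tP: "t \<le> poly p (2 * ?n)"
      using t(1) poly_nat_mono[OF len_y, of p] by simp
    \<comment> \<open>The symbols of \<open>?y\<close> are at most 4 and so differ from the marked
      blank \<open>G\<close>: freshly written tapes unmark to themselves.\<close>
    have init: "tm_init M ?y = (start_state M, map (\<lambda>t. unmark \<circ> t) (zipper [] ?y # ?W))"
    proof -
      have "unmark \<circ> zipper [] z = zipper [] z" if "z \<in> lists {1..4}" for z
      proof
        fix i
        have "zipper [] z i \<in> insert 0 (set z)" by (simp add: zipper_def)
        then have "zipper [] z i \<noteq> G" using that four_less_G by fastforce
        then show "(unmark \<circ> zipper [] z) i = zipper [] z i" by (simp add: unmark_def)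
      qed
      from this[OF y] this[of "[]"] show ?thesis
        by (simp add: tm_init_def input_tape_eq_zipper blank_tape_eq_zipper N)
    qed
    \<comment> \<open>The written cells count as visited; the \<open>max\<close> covers an empty
      tape, where only the head cell does.\<close>
    have good: "sim_tape (2 * ?n) (zipper [] z)" if z: "z \<in> lists {1..4}" "length z \<le> 2 * ?n" for z
    proof -
      have "zipper [] z i \<le> G" for i
      proof -
        have "zipper [] z i \<in> insert 0 (set z)" by (simp add: zipper_def)
        then show ?thesis using z four_less_G by fastforce
      qed
      moreover have "z ! j \<noteq> 0" if "j < length z" for j
        using z nth_mem[OF that] by fastforce
      then have "segment 0 (max 1 (int (length z))) ((zipper [] z)(0 := 1))"
        unfolding segment_def zipper_def by (auto simp: nat_less_iff)
      ultimately show ?thesis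
        unfolding sim_tape_def using z(2)
        by (intro conjI allI exI[of _ 0] exI[of _ "max 1 (int (length z))"]) auto
    qed
    have "length (zipper [] ?y # ?W) = N" "\<forall>u \<in> set (zipper [] ?y # ?W). sim_tape (2 * ?n) u"
      "fst ((tm_step M ^^ t) (start_state M, map (\<lambda>t. unmark \<circ> t) (zipper [] ?y # ?W))) = ?h"
      "?h = accept_state M \<or> ?h = reject_state M"
      using t(2) init N good[OF y len_y] good[of "[]"] by auto
    from sim_run[OF states_M(1) this]
    obtain ts' where run: "reaches searcher t (start_state M, zipper [] x # ?S # zipper [] ?y # ?W)
      (?h, zipper [] x # ?S # ts')" "length ts' = N" "\<forall>u \<in> set ts'. sim_tape (2 * ?n + t) u"
      by blast
    from reaches_trans[OF written run(1)]
    have run': "reaches searcher (5 * ?n + 4 + poly p (2 * ?n))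
      (Q + 6, zipper [] x # zipper ls rest # replicate N (zipper [] []))
      (?h, zipper [] x # ?S # ts')"
      by (rule reaches_mono) (use tP in simp)
    have inner: "inner_blocks (4 # rest) = insert b (inner_blocks (4 # r))"
      using inner_blocks_Cons[OF br(2)] br(1) by simp
    show ?thesis
    proof (cases "?y \<in> L")
      case True
      have "tm_step searcher (accept_state M, zipper [] x # ?S # ts') = (Q, zipper [] x # ?S # ts')"
        using states_M by (simp add: o_def del: zipper_Stay)
      from reaches_Suc[OF this reaches_refl[of _ 0]]
      have "reaches searcher 1 (?h, zipper [] x # ?S # ts') (Q, zipper [] x # ?S # ts')"
        using True by (simp del: tm_step.simps)
      from reaches_trans[OF run' this]
      have "reaches searcher ((length rest + 1) * ?K)
        (Q + 6, zipper [] x # zipper ls rest # replicate N (zipper [] []))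
        (Q, zipper [] x # ?S # ts')"
        by (rule reaches_mono) simp
      then show ?thesis using True inner by auto
    next
      case False
      have "reaches searcher (3 * (2 * ?n + t) + 4) (?h, zipper [] x # ?S # ts')
        (Q + 6, zipper [] x # ?S # replicate N (zipper [] []))"
        using clean[OF run(3,2)] False by simp
      from reaches_trans[OF run' this]
      have iter: "reaches searcher ?K
        (Q + 6, zipper [] x # zipper ls rest # replicate N (zipper [] []))
        (Q + 6, zipper [] x # ?S # replicate N (zipper [] []))"
        by (rule reaches_mono) (use tP in simp)
      obtain ts'' where "reaches searcher ((length r + 1) * ?K)
        (Q + 6, zipper [] x # ?S # replicate N (zipper [] []))
        (if \<exists>b \<in> inner_blocks (4 # r). x @ b @ [4] \<in> L then Q else Q + 1, ts'')"
        using less.hyps[of r "4 # rev b @ ls"] r less.prems(2) br by auto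
      \<comment> \<open>\<open>rest\<close> is longer than \<open>r\<close> by at least the
        terminator, which pays for this round.\<close>
      from reaches_trans[OF iter this]
      have "reaches searcher ((length rest + 1) * ?K)
        (Q + 6, zipper [] x # zipper ls rest # replicate N (zipper [] []))
        (if \<exists>b \<in> inner_blocks (4 # r). x @ b @ [4] \<in> L then Q else Q + 1, ts'')"
        by (rule reaches_mono) (simp add: br(1) algebra_simps)
      moreover have "(\<exists>b \<in> inner_blocks (4 # rest). x @ b @ [4] \<in> L) \<longleftrightarrow>
          (\<exists>b \<in> inner_blocks (4 # r). x @ b @ [4] \<in> L)"
        using False inner by simp
      ultimately show ?thesis by (simp only:) blast
    qed
  qed
qed

text \<open>The first \<open>[:20, 20:]\<close> pays for copying, checking and skipping the first
  block, \<open>[:1, 1:]\<close> counts the rounds, and the last factor bounds one round, with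
  \<open>[:0, 2:]\<close> doubling the input length.\<close>

lemma searcher_decides:
  "decides_in_time searcher 4 (appending_inner_block L)
     (poly ([:20, 20:] + [:1, 1:] * ([:20, 20:] + smult 5 (pcompose p [:0, 2:]))))"
proof -
  have run: "\<exists>ts'. reaches searcher
      (20 + 20 * length x + (length x + 1) * (20 * length x + 20 + 5 * poly p (2 * length x)))
      (tm_init searcher x) (if x \<in> appending_inner_block L then Q else Q + 1, ts')"
    if x: "x \<in> lists {1..4}" for x
  proof -
    let ?n = "length x"
    let ?B = "replicate N (zipper [] [])"
    have x0: "0 \<notin> set x" using x by auto
    have "tm_init searcher x = (Q + 2, zipper [] x # zipper [] [] # ?B)"
      by (simp add: tm_init_def input_tape_eq_zipper blank_tape_eq_zipper)
    with copy_input[OF x0, of "[]" ?B]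
    have copied: "reaches searcher ?n (tm_init searcher x)
      (Q + 2, zipper (rev x) [] # zipper (rev x) [] # ?B)" by simp
    show ?thesis
    proof (cases "x \<noteq> [] \<and> last x = 4")
      case False
      \<comment> \<open>An empty input shows the blank in place of a last symbol, so state
        \<open>Q + 3\<close> rejects it like any other symbol than 4.\<close>
      have "\<exists>l r. tm_step searcher (Q + 2, zipper (rev x) [] # zipper (rev x) [] # ?B) =
          (Q + 3, zipper l r # zipper l r # ?B) \<and> zipper l r 0 \<noteq> 4"
      proof (cases "rev x")
        case Nil
        show ?thesis unfolding Nil
          by (intro exI[of _ "[]"]) (simp add: o_def)
      next
        case (Cons a l)
        then have "a \<noteq> 4" using False by (metis hd_rev list.sel(1) rev.simps(1) list.distinct(1))
        then show ?thesis unfolding Cons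
          by (intro exI[of _ l] exI[of _ "[a]"]) (simp add: o_def)
      qed
      then obtain l r where step: "tm_step searcher (Q + 2, zipper (rev x) [] # zipper (rev x) [] # ?B) =
          (Q + 3, zipper l r # zipper l r # ?B)" and neq: "zipper l r 0 \<noteq> 4" by blast
      have "tm_step searcher (Q + 3, zipper l r # zipper l r # ?B) = (Q + 1, zipper l r # zipper l r # ?B)"
        using neq by (simp add: o_def del: zipper_Stay)
      from reaches_trans[OF copied reaches_Suc[OF step reaches_Suc[OF this reaches_refl[of _ 0]]]]
      have "reaches searcher
          (20 + 20 * ?n + (?n + 1) * (20 * ?n + 20 + 5 * poly p (2 * ?n)))
          (tm_init searcher x) (Q + 1, zipper l r # zipper l r # ?B)"
        by (rule reaches_mono) simp
      moreover have "x \<notin> appending_inner_block L"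
        using False by (auto simp: appending_inner_block_def)
      ultimately show ?thesis by auto
    next
      case True
      then obtain l where x_eq: "x = rev l @ [4]"
        by (metis append_butlast_last_id rev_rev_ident)
      with x0 have l: "0 \<notin> set l" "rev x = 4 # l" "?n = length l + 1" by auto
      have step: "tm_step searcher (Q + 2, zipper (rev x) [] # zipper (rev x) [] # ?B) =
          (Q + 3, zipper l [4] # zipper l [4] # ?B)"
        "tm_step searcher (Q + 3, zipper l [4] # zipper l [4] # ?B) =
          (Q + 4, zipper l [4] # zipper l [4] # ?B)"
        unfolding l(2) by (simp_all add: o_def)
      have "reaches searcher (length l + 2) (Q + 4, zipper l [4] # zipper l [4] # ?B)
          (Q + 5, zipper [] x # zipper [] x # ?B)"
        using rewind_copies[OF l(1), of 4 "[]" ?B] x_eq by simp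
      from reaches_trans[OF copied reaches_Suc[OF step(1) reaches_Suc[OF step(2) this]]]
      have rewound: "reaches searcher (2 * ?n + 3) (tm_init searcher x)
          (Q + 5, zipper [] x # zipper [] x # ?B)"
        by (rule reaches_mono) (use l in simp)
      \<comment> \<open>Passing the first 4 brings the second head to where
        \<open>search_loop\<close> expects it.\<close>
      obtain c r where cr: "x = c @ 4 # r" "4 \<notin> set c"
        using True split_list_first[of 4 x] last_in_set by metis
      have "reaches searcher (length c + 1) (Q + 5, zipper [] x # zipper [] x # ?B)
          (Q + 6, zipper [] x # zipper (4 # rev c) r # ?B)"
        using skip_block[OF cr(2), of "zipper [] x" "[]" r ?B] cr(1) by simp
      from reaches_trans[OF rewound this]
      have init: "reaches searcher (20 + 20 * ?n) (tm_init searcher x)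
          (Q + 6, zipper [] x # zipper (4 # rev c) r # ?B)"
        by (rule reaches_mono) (simp add: cr(1))
      obtain ts' where "reaches searcher ((length r + 1) * (20 * ?n + 20 + 5 * poly p (2 * ?n)))
          (Q + 6, zipper [] x # zipper (4 # rev c) r # ?B)
          (if \<exists>b \<in> inner_blocks (4 # r). x @ b @ [4] \<in> L then Q else Q + 1, ts')"
        using search_loop[OF x, of r "4 # rev c"] True x cr(1) by auto
      moreover have "(\<exists>b \<in> inner_blocks (4 # r). x @ b @ [4] \<in> L) \<longleftrightarrow> x \<in> appending_inner_block L"
        unfolding appending_inner_block_def using True x inner_blocks_append[OF cr(2), of r] cr(1)
        by simp
      ultimately have "reaches searcher ((length r + 1) * (20 * ?n + 20 + 5 * poly p (2 * ?n)))
          (Q + 6, zipper [] x # zipper (4 # rev c) r # ?B)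
          (if x \<in> appending_inner_block L then Q else Q + 1, ts')"
        by (simp only:)
      from reaches_trans[OF init this]
      have "reaches searcher
          (20 + 20 * ?n + (?n + 1) * (20 * ?n + 20 + 5 * poly p (2 * ?n)))
          (tm_init searcher x) (if x \<in> appending_inner_block L then Q else Q + 1, ts')"
        by (rule reaches_mono) (intro add_mono mult_mono; simp add: cr(1))
      then show ?thesis by blast
    qed
  qed
  have "\<exists>t \<le> poly ([:20, 20:] + [:1, 1:] * ([:20, 20:] + smult 5 (pcompose p [:0, 2:]))) (length x).
      fst ((tm_step searcher ^^ t) (tm_init searcher x)) =
      (if x \<in> appending_inner_block L then accept_state searcher else reject_state searcher)"
    if "x \<in> lists {1..4}" for x
  proof -
    have eq: "poly ([:20, 20:] + [:1, 1:] * ([:20, 20:] + smult 5 (pcompose p [:0, 2:]))) n =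
        20 + 20 * n + (n + 1) * (20 * n + 20 + 5 * poly p (2 * n))" for n
    proof -
      have "poly (pcompose p [:0, 2:]) n = poly p (2 * n)"
        unfolding poly_pcompose by (rule arg_cong[of _ _ "poly p"]) simp
      then show ?thesis by (simp add: algebra_simps)
    qed
    from run[OF that] obtain t ts' where
      t: "t \<le> 20 + 20 * length x + (length x + 1) * (20 * length x + 20 + 5 * poly p (2 * length x))"
      "(tm_step searcher ^^ t) (tm_init searcher x) =
        (if x \<in> appending_inner_block L then Q else Q + 1, ts')"
      unfolding reaches_def by blast
    show ?thesis
      unfolding eq searcher_simps using t(1) arg_cong[OF t(2), of fst] by auto
  qed
  moreover have "appending_inner_block L \<subseteq> lists {1..4}"
    by (auto simp: appending_inner_block_def)
  ultimately show ?thesis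
    unfolding decides_in_time_def using wf_searcher four_less_G by (simp del: lists_eq_set)
qed

end

section \<open>Closure of P and iteration over the manipulators\<close>

lemma class_P_appending_inner_block:
  assumes "L \<in> class_P 4"
  shows "appending_inner_block L \<in> class_P 4"
proof -
  obtain M and p :: "nat poly" where "decides_in_time M 4 L (poly p)"
    using assms by (auto simp: class_P_def)
  then interpret block_search M L p
    by unfold_locales
  show ?thesis
    unfolding class_P_def using searcher_decides by blast
qed

lemma winner_language_conformant_class_P:
  assumes "winner_language (winner_problem E) \<in> class_P 4"
  shows "winner_language (conformant_winner_problem E k) \<in> class_P 4"
proof (induction k)
  case (Suc k)
  then show ?case
    unfolding winner_language_conformant_Suc by (rule class_P_appending_inner_block)
qed (simp add: conformant_winner_problem_0 assms)

theorem theorem2: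
  fixes E :: rule and k :: nat
  assumes "voting_rule E"
    and "winner_language (winner_problem E) \<in> class_P 4"
  shows "conformant_language {(C, V, w, p). (C, V, w, p) \<in> conformant_manipulation E \<and> w = k}
           \<in> class_P 4"
proof -
  have prefix: "(\<lambda>x. replicate n 3 @ x) ` L \<in> class_P 4" if "L \<in> class_P 4" for n L
  proof (induction n)
    case (Suc n)
    have "(\<lambda>x. replicate (Suc n) 3 @ x) ` L = Cons 3 ` (\<lambda>x. replicate n 3 @ x) ` L"
      by (simp add: image_image)
    then show ?case
      using class_P_Cons[OF Suc, of 3] by simp
  qed (use that in simp)
  let ?L = "winner_language (conformant_winner_problem E k)"
  \<comment> \<open>The prefix is built from the inside out: first the 4, then the \<open>k\<close>
    symbols 3.\<close>
  have "Cons 4 ` ?L \<in> class_P 4"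
    by (rule class_P_Cons) (simp_all add: winner_language_conformant_class_P assms(2))
  from prefix[OF this, of k] show ?thesis
    unfolding conformant_language_eq by (simp add: image_image)
qed

end
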